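(* Let $n\in\mathbb{N}$ and let $\Omega\in\tau_s(\mathbb{H}_s^n)$ be self-stem-preserving. Then $(\mathcal{SR}(\Omega),+,* )$ is an associative unitary real algebra.
   Context: $\mathbb{H}$ is the algebra of quaternions, $\mathbb{S}:=\{I\in\mathbb{H}: I^2=-1\}$, and for $I\in\mathbb{S}$, $\mathbb{C}_I:=\mathbb{R}+\mathbb{R}I$, $\mathbb{C}_I^n:=(\mathbb{C}_I)^n$. The weakly slice cone is $\mathbb{H}_s^n:=\bigcup_{I\in\mathbb{S}}\mathbb{C}_I^n\subset\mathbb{H}^n$. For $\Omega\subset\mathbb{H}_s^n$ put $\Omega_I:=\Omega\cap\mathbb{C}_I^n$. The slice topology $\tau_s(\mathbb{H}_s^n)$ consists of all $\Omega\subset\mathbb{H}_s^n$ such that $\Omega_I$ is open in $\mathbb{C}_I^n$ (Euclidean topology) for every $I\in\mathbb{S}$. For $z=x+yi\in\mathbb{C}^n$ ($x,y\in\mathbb{R}^n$) and $I\in\mathbb{S}$, $z^I:=x+yI\in\mathbb{C}_I^n$; for a path $\gamma:[0,1]\to\mathbb{C}^n$, $\gamma^I(t):=(\gamma(t))^I$. $\mathscr{P}(\mathbb{C}^n)$ is the set of continuous $\gamma:[0,1]\to\mathbb{C}^n$ with $\gamma(0)\in\mathbb{R}^n$. Writing $\gamma^I\subset\Omega$ for $\gamma^I([0,1])\subset\Omega$, set $\mathbb{S}(\Omega,\gamma):=\{I\in\mathbb{S}:\gamma^I\subset\Omega\}$ and $\mathscr{P}(\mathbb{C}^n,\Omega):=\{\gamma\in\mathscr{P}(\mathbb{C}^n):\mathbb{S}(\Omega,\gamma)\neq\varnothing\}$.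 $\Omega\subset\mathbb{H}_s^n$ is real-path-connected if for each $q\in\Omega$ there are $\gamma\in\mathscr{P}(\mathbb{C}^n,\Omega)$ and $I\in\mathbb{S}(\Omega,\gamma)$ with $\gamma^I(1)=q$. $\Omega$ is self-stem-preserving if it is real-path-connected and $\Omega$-stem-preserving, the latter meaning: (i) $|\mathbb{S}(\Omega,\gamma)|\geq 2$ for every $\gamma\in\mathscr{P}(\mathbb{C}^n,\Omega)$, and (ii) $|\mathbb{S}(\Omega,\alpha)\cap\mathbb{S}(\Omega,\beta)|\neq 1$ for all $\alpha,\beta\in\mathscr{P}(\mathbb{C}^n,\Omega)$ with $\alpha(1)=\beta(1)$. Slice regular functions: for $\Omega\in\tau_s(\mathbb{H}_s^n)$, $f:\Omega\to\mathbb{H}$ is (weakly) slice regular if for every $I\in\mathbb{S}$ the restriction $f_I:=f|_{\Omega_I}$ is real differentiable and $\frac12\left(\frac{\partial}{\partial x_\ell}+I\frac{\partial}{\partial y_\ell}\right)f_I(x+yI)=0$ on $\Omega_I$ for each $\ell=1,\dots,n$. The set of these is $\mathcal{SR}(\Omega)$. Path-slice functions: $f:\Omega\to\mathbb{H}$ is path-slice if there is $F:\mathscr{P}(\mathbb{C}^n,\Omega)\to\mathbb{H}^{2\times1}$ (a path-slice stem function of $f$) with $f(\gamma^I(1))=(1,I)F(\gamma)$ for all $\gamma\in\mathscr{P}(\mathbb{C}^n,\Omega)$, $I\in\mathbb{S}(\Omega,\gamma)$. The set of path-slice functions is $\mathcal{PS}(\Omega)$. It is a known fact that $\mathcal{SR}(\Omega)\subset\mathcal{PS}(\Omega)$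 for $\Omega\in\tau_s(\mathbb{H}_s^n)$. For $\Omega$ self-stem-preserving and $g\in\mathcal{PS}(\Omega)$, $F_{\Omega}^g:\mathscr{P}(\mathbb{C}^n,\Omega)\to\mathbb{H}^{2\times1}$ denotes the path-slice stem function of $g$ (known to be unique in this situation). Define $\mathfrak{I}:\mathbb{H}_s^n\to\mathbb{S}\cup\{0\}$ by $\mathfrak{I}(q)=0$ if $q\in\mathbb{R}^n$, and otherwise $\mathfrak{I}(q)=\frac{q_\imath-\mathrm{Re}(q_\imath)}{|q_\imath-\mathrm{Re}(q_\imath)|}$, where $\imath$ is the smallest index with $q_\imath\notin\mathbb{R}$. For $q\in\Omega$ let $\mathscr{F}_{\Omega}^g(q):=(g(q),0)^T$ if $q\in\mathbb{R}^n$, and $\mathscr{F}_{\Omega}^g(q):=F_{\Omega}^g(\gamma)$ if $q\notin\mathbb{R}^n$, where $\gamma\in\mathscr{P}(\mathbb{C}^n,\Omega)$ is any path with $\gamma^{\mathfrak{I}(q)}\subset\Omega$ and $\gamma^{\mathfrak{I}(q)}(1)=q$ (known to be well defined). For $f,g\in\mathcal{PS}(\Omega)$ the $*$-product is $f*g:\Omega\to\mathbb{H}$, $(f*g)(q):=\big(f(q),\mathfrak{I}(q)f(q)\big)\,\mathscr{F}_{\Omega}^g(q)$ (row times column). Addition $+$ and multiplication by real scalars are pointwise. *)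

theory Defs
  imports "HOL-Analysis.Analysis" "HOL-Algebra.Algebraic_Closure_Type"
begin

datatype quat = Quat (qre: real) (qim1: real) (qim2: real) (qim3: real)

lemma quat_eq_iff:
  "p = q \<longleftrightarrow> qre p = qre q \<and> qim1 p = qim1 q \<and> qim2 p = qim2 q \<and> qim3 p = qim3 q"
  by (auto intro: quat.expand)

instantiation quat :: ab_group_add
begin

definition zero_quat_def: "0 = Quat 0 0 0 0"

definition plus_quat_def:
  "p + q = Quat (qre p + qre q) (qim1 p + qim1 q) (qim2 p + qim2 q) (qim3 p + qim3 q)"

definition uminus_quat_def:
  "- p = Quat (- qre p) (- qim1 p) (- qim2 p) (- qim3 p)"

definition minus_quat_def:
  "p - q = Quat (qre p - qre q) (qim1 p - qim1 q) (qim2 p - qim2 q) (qim3 p - qim3 q)"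

instance
  by standard
    (simp_all add: quat_eq_iff zero_quat_def plus_quat_def uminus_quat_def minus_quat_def)

end

lemma quat_add_sel [simp]:
  "qre 0 = 0" "qim1 0 = 0" "qim2 0 = 0" "qim3 0 = 0"
  "qre (p + q) = qre p + qre q" "qim1 (p + q) = qim1 p + qim1 q"
  "qim2 (p + q) = qim2 p + qim2 q" "qim3 (p + q) = qim3 p + qim3 q"
  "qre (- p) = - qre p" "qim1 (- p) = - qim1 p"
  "qim2 (- p) = - qim2 p" "qim3 (- p) = - qim3 p"
  "qre (p - q) = qre p - qre q" "qim1 (p - q) = qim1 p - qim1 q"
  "qim2 (p - q) = qim2 p - qim2 q" "qim3 (p - q) = qim3 p - qim3 q"
  by (simp_all add: zero_quat_def plus_quat_def uminus_quat_def minus_quat_def)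

instantiation quat :: real_algebra_1
begin

definition one_quat_def: "1 = Quat 1 0 0 0"

definition times_quat_def:
  "p * q = Quat
     (qre p * qre q - qim1 p * qim1 q - qim2 p * qim2 q - qim3 p * qim3 q)
     (qre p * qim1 q + qim1 p * qre q + qim2 p * qim3 q - qim3 p * qim2 q)
     (qre p * qim2 q - qim1 p * qim3 q + qim2 p * qre q + qim3 p * qim1 q)
     (qre p * qim3 q + qim1 p * qim2 q - qim2 p * qim1 q + qim3 p * qre q)"

definition scaleR_quat_def:
  "scaleR r p = Quat (r * qre p) (r * qim1 p) (r * qim2 p) (r * qim3 p)"

instance
  by standard
    (simp_all add: quat_eq_iff one_quat_def times_quat_def scaleR_quat_def algebra_simps)

end

lemma quat_algebra_sel [simp]:
  "qre 1 = 1" "qim1 1 = 0" "qim2 1 = 0" "qim3 1 = 0"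
  "qre (scaleR r p) = r * qre p" "qim1 (scaleR r p) = r * qim1 p"
  "qim2 (scaleR r p) = r * qim2 p" "qim3 (scaleR r p) = r * qim3 p"
  by (simp_all add: one_quat_def scaleR_quat_def)

instantiation quat :: real_inner
begin

definition inner_quat_def:
  "inner p q = qre p * qre q + qim1 p * qim1 q + qim2 p * qim2 q + qim3 p * qim3 q"

definition norm_quat_def: "norm (p::quat) = sqrt (inner p p)"

definition sgn_quat_def: "sgn (p::quat) = p /\<^sub>R norm p"

definition dist_quat_def: "dist (p::quat) q = norm (p - q)"

definition uniformity_quat_def:
  "(uniformity :: (quat \<times> quat) filter) = (INF e\<in>{0<..}. principal {(x, y). dist x y < e})"

definition open_quat_def:
  "open (U :: quat set) \<longleftrightarrow> (\<forall>x\<in>U. \<forall>\<^sub>F (x', y) in uniformity. x' = x \<longrightarrow> y \<in> U)"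

instance
proof
  fix p q r :: quat and a :: real
  show "inner p q = inner q p"
    by (simp add: inner_quat_def algebra_simps)
  show "inner (p + q) r = inner p r + inner q r"
    by (simp add: inner_quat_def algebra_simps)
  show "inner (scaleR a p) q = a * inner p q"
    by (simp add: inner_quat_def algebra_simps)
  show nonneg: "0 \<le> inner p p"
    by (simp add: inner_quat_def)
  show "inner p p = 0 \<longleftrightarrow> p = 0"
  proof
    assume "inner p p = 0"
    then have "(qre p)\<^sup>2 + (qim1 p)\<^sup>2 + (qim2 p)\<^sup>2 + (qim3 p)\<^sup>2 = 0"
      by (simp add: inner_quat_def power2_eq_square)
    then show "p = 0"
      by (simp add: quat_eq_iff add_nonneg_eq_0_iff)
  qed (simp add: inner_quat_def)
qed (fact norm_quat_def sgn_quat_def dist_quat_def uniformity_quat_def open_quat_def)+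

end

instantiation quat :: real_normed_div_algebra
begin

definition inverse_quat_def:
  "inverse p = Quat (qre p) (- qim1 p) (- qim2 p) (- qim3 p) /\<^sub>R inner p p"

definition divide_quat_def: "(p::quat) div q = p * inverse q"

instance
proof
  fix p q :: quat
  let ?c = "Quat (qre p) (- qim1 p) (- qim2 p) (- qim3 p)"
  have "?c * p = inner p p *\<^sub>R 1" "p * ?c = inner p p *\<^sub>R 1"
    by (simp_all add: quat_eq_iff times_quat_def inner_quat_def)
  then show "inverse p * p = 1" "p * inverse p = 1" if "p \<noteq> 0"
    using that by (simp_all add: inverse_quat_def)
  show "p div q = p * inverse q"
    by (fact divide_quat_def)
  show "inverse (0::quat) = 0"
    by (simp add: quat_eq_iff inverse_quat_def)
  have "inner (p * q) (p * q) = inner p p * inner q q"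
    by (simp add: inner_quat_def times_quat_def algebra_simps)
  then show "norm (p * q) = norm p * norm q"
    by (simp add: norm_quat_def real_sqrt_mult)
qed

end

instantiation quat :: euclidean_space
begin

definition Basis_quat_def: "Basis = {Quat 1 0 0 0, Quat 0 1 0 0, Quat 0 0 1 0, Quat 0 0 0 1}"

instance
proof
  fix u v :: quat
  show "(Basis :: quat set) \<noteq> {}" "finite (Basis :: quat set)"
    by (simp_all add: Basis_quat_def)
  show "inner u v = (if u = v then 1 else 0)" if "u \<in> Basis" "v \<in> Basis"
    using that unfolding Basis_quat_def inner_quat_def by fastforce
  show "(\<forall>u\<in>Basis. inner v u = 0) \<longleftrightarrow> v = 0"
    by (simp add: Basis_quat_def inner_quat_def) (auto simp: quat_eq_iff)
qed

end

definition imag_units :: "quat set" where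
  "imag_units = {I. I\<^sup>2 = - 1}"

definition cplx_plane :: "quat \<Rightarrow> quat set" where
  "cplx_plane I = {of_real a + of_real b * I | a b. True}"

definition cplx_space :: "quat \<Rightarrow> (quat ^ 'n) set" where
  "cplx_space I = {q. \<forall>l. q $ l \<in> cplx_plane I}"

definition slice_cone :: "(quat ^ 'n) set" where
  "slice_cone = (\<Union>I\<in>imag_units. cplx_space I)"

definition slice_topology :: "(quat ^ 'n) topology" where
  "slice_topology = topology (\<lambda>\<Omega>. \<Omega> \<subseteq> slice_cone \<and>
     (\<forall>I\<in>imag_units. openin (top_of_set (cplx_space I)) (\<Omega> \<inter> cplx_space I)))"

lemma openin_slice_topology:
  fixes \<Omega> :: "(quat ^ 'n) set"
  shows "openin slice_topology \<Omega> \<longleftrightarrow> \<Omega> \<subseteq> slice_cone \<and>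
     (\<forall>I\<in>imag_units. openin (top_of_set (cplx_space I)) (\<Omega> \<inter> cplx_space I))"
proof -
  have "istopology (\<lambda>\<Omega> :: (quat ^ 'n) set. \<Omega> \<subseteq> slice_cone \<and>
     (\<forall>I\<in>imag_units. openin (top_of_set (cplx_space I)) (\<Omega> \<inter> cplx_space I)))"
  proof (unfold istopology_def, intro conjI allI impI ballI, goal_cases)
    case (1 S T)
    then show ?case by auto
  next
    case (2 S T I)
    then have "openin (top_of_set (cplx_space I)) ((S \<inter> cplx_space I) \<inter> (T \<inter> cplx_space I))"
      by (simp add: openin_Int del: Int_iff)
    moreover have "(S \<inter> cplx_space I) \<inter> (T \<inter> cplx_space I) = S \<inter> T \<inter> cplx_space I"
      by blast
    ultimately show ?case by simp
  next
    case (3 K)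
    then show ?case by auto
  next
    case (4 K I)
    then have "openin (top_of_set (cplx_space I)) (\<Union>S\<in>K. S \<inter> cplx_space I)"
      by (intro openin_Union) blast
    moreover have "(\<Union>S\<in>K. S \<inter> cplx_space I) = \<Union>K \<inter> cplx_space I"
      by blast
    ultimately show ?case by simp
  qed
  then show ?thesis
    by (simp add: slice_topology_def topology_inverse')
qed

definition slice_lift :: "quat \<Rightarrow> complex ^ 'n \<Rightarrow> quat ^ 'n" where
  "slice_lift I z = (\<chi> l. of_real (Re (z $ l)) + of_real (Im (z $ l)) * I)"

definition path_lift :: "quat \<Rightarrow> (real \<Rightarrow> complex ^ 'n) \<Rightarrow> real \<Rightarrow> quat ^ 'n" where
  "path_lift I \<gamma> = (\<lambda>t. slice_lift I (\<gamma> t))"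

text \<open>As usual for \<^const>\<open>path\<close>, only the values on the unit interval matter; paths are not
  required to be normalised outside of it.\<close>

definition real_start_paths :: "(real \<Rightarrow> complex ^ 'n) set" where
  "real_start_paths = {\<gamma>. path \<gamma> \<and> (\<forall>l. pathstart \<gamma> $ l \<in> \<real>)}"

definition path_units :: "(quat ^ 'n) set \<Rightarrow> (real \<Rightarrow> complex ^ 'n) \<Rightarrow> quat set" where
  "path_units \<Omega> \<gamma> = {I \<in> imag_units. path_image (path_lift I \<gamma>) \<subseteq> \<Omega>}"

definition paths_in :: "(quat ^ 'n) set \<Rightarrow> (real \<Rightarrow> complex ^ 'n) set" where
  "paths_in \<Omega> = {\<gamma> \<in> real_start_paths. path_units \<Omega> \<gamma> \<noteq> {}}"

definition real_path_connected :: "(quat ^ 'n) set \<Rightarrow> bool" where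
  "real_path_connected \<Omega> \<longleftrightarrow>
     (\<forall>q\<in>\<Omega>. \<exists>\<gamma>\<in>paths_in \<Omega>. \<exists>I\<in>path_units \<Omega> \<gamma>. pathfinish (path_lift I \<gamma>) = q)"

text \<open>The set of units of a path may be infinite, in which case its \<^const>\<open>card\<close> is \<open>0\<close>.\<close>

definition stem_preserving :: "(quat ^ 'n) set \<Rightarrow> bool" where
  "stem_preserving \<Omega> \<longleftrightarrow>
     (\<forall>\<gamma>\<in>paths_in \<Omega>. infinite (path_units \<Omega> \<gamma>) \<or> card (path_units \<Omega> \<gamma>) \<ge> 2) \<and>
     (\<forall>\<alpha>\<in>paths_in \<Omega>. \<forall>\<beta>\<in>paths_in \<Omega>. pathfinish \<alpha> = pathfinish \<beta> \<longrightarrow>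
        card (path_units \<Omega> \<alpha> \<inter> path_units \<Omega> \<beta>) \<noteq> 1)"

definition self_stem_preserving :: "(quat ^ 'n) set \<Rightarrow> bool" where
  "self_stem_preserving \<Omega> \<longleftrightarrow> real_path_connected \<Omega> \<and> stem_preserving \<Omega>"

text \<open>Functions on \<open>\<Omega>\<close> are represented extensionally, i.e. as total functions that are
  \<^const>\<open>undefined\<close> outside of \<open>\<Omega>\<close>, so that equality is equality of functions on \<open>\<Omega>\<close>.\<close>

definition partial_x :: "'n :: finite \<Rightarrow> (complex ^ 'n \<Rightarrow> quat) \<Rightarrow> complex ^ 'n \<Rightarrow> quat" where
  "partial_x l g z = vector_derivative (\<lambda>t. g (z + axis l (of_real t))) (at 0)"

definition partial_y :: "'n :: finite \<Rightarrow> (complex ^ 'n \<Rightarrow> quat) \<Rightarrow> complex ^ 'n \<Rightarrow> quat" where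
  "partial_y l g z = vector_derivative (\<lambda>t. g (z + axis l (of_real t * \<i>))) (at 0)"

definition slice_regular :: "(quat ^ 'n) set \<Rightarrow> (quat ^ 'n \<Rightarrow> quat) set" where
  "slice_regular \<Omega> = {f \<in> extensional \<Omega>. \<forall>I\<in>imag_units.
     f differentiable_on (\<Omega> \<inter> cplx_space I) \<and>
     (\<forall>z l. slice_lift I z \<in> \<Omega> \<longrightarrow>
        (1/2) *\<^sub>R (partial_x l (\<lambda>w. f (slice_lift I w)) z
                  + I * partial_y l (\<lambda>w. f (slice_lift I w)) z) = 0)}"

definition row_times_col :: "quat \<Rightarrow> quat \<Rightarrow> quat ^ 2 \<Rightarrow> quat" where
  "row_times_col a b v = a * v $ 1 + b * v $ 2"

definition is_stem_function ::
    "(quat ^ 'n) set \<Rightarrow> (quat ^ 'n \<Rightarrow> quat) \<Rightarrow> ((real \<Rightarrow> complex ^ 'n) \<Rightarrow> quat ^ 2) \<Rightarrow> bool" where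
  "is_stem_function \<Omega> f F \<longleftrightarrow> F \<in> extensional (paths_in \<Omega>) \<and>
     (\<forall>\<gamma>\<in>paths_in \<Omega>. \<forall>I\<in>path_units \<Omega> \<gamma>.
        f (pathfinish (path_lift I \<gamma>)) = row_times_col 1 I (F \<gamma>))"

definition path_slice :: "(quat ^ 'n) set \<Rightarrow> (quat ^ 'n \<Rightarrow> quat) set" where
  "path_slice \<Omega> = {f \<in> extensional \<Omega>. \<exists>F. is_stem_function \<Omega> f F}"

text \<open>For self-stem-preserving \<open>\<Omega>\<close> and path-slice \<open>g\<close>, the description below is uniquely satisfied;
  extensionality of \<open>F\<close> fixes its irrelevant values outside \<^term>\<open>paths_in \<Omega>\<close>.\<close>

definition stem_function ::
    "(quat ^ 'n) set \<Rightarrow> (quat ^ 'n \<Rightarrow> quat) \<Rightarrow> (real \<Rightarrow> complex ^ 'n) \<Rightarrow> quat ^ 2" where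
  "stem_function \<Omega> g = (THE F. is_stem_function \<Omega> g F)"

text \<open>This is the function \<open>\<JJ>\<close>, normalising the imaginary part of the first non-real component; the
  linear order on the index type gives meaning to "first".\<close>

definition imag_unit_of :: "quat ^ 'n :: {finite, linorder} \<Rightarrow> quat" where
  "imag_unit_of q = (if \<forall>l. q $ l \<in> \<real> then 0
     else let p = q $ Min {l. q $ l \<notin> \<real>}
          in (p - of_real (qre p)) /\<^sub>R norm (p - of_real (qre p)))"

definition point_stem ::
    "(quat ^ 'n :: {finite, linorder}) set \<Rightarrow> ((quat, 'n) vec \<Rightarrow> quat) \<Rightarrow> (quat, 'n) vec \<Rightarrow> quat ^ 2" where
  "point_stem \<Omega> g q = (if \<forall>l. q $ l \<in> \<real> then vector [g q, 0]
     else stem_function \<Omega> g (SOME \<gamma>. \<gamma> \<in> paths_in \<Omega> \<and>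
            path_image (path_lift (imag_unit_of q) \<gamma>) \<subseteq> \<Omega> \<and>
            pathfinish (path_lift (imag_unit_of q) \<gamma>) = q))"

definition star_prod ::
    "(quat ^ 'n :: {finite, linorder}) set \<Rightarrow> ((quat, 'n) vec \<Rightarrow> quat) \<Rightarrow> ((quat, 'n) vec \<Rightarrow> quat) \<Rightarrow>
     (quat, 'n) vec \<Rightarrow> quat" where
  "star_prod \<Omega> f g =
     restrict (\<lambda>q. row_times_col (f q) (imag_unit_of q * f q) (point_stem \<Omega> g q)) \<Omega>"

text \<open>The library locale \<^locale>\<open>Module.algebra\<close> requires a commutative product; the following is
  the analogous notion for a not necessarily commutative ring.\<close>

locale assoc_unital_algebra = module R M + ring M for R (structure) and M (structure) +
  assumes smult_mult_left:
      "\<lbrakk>a \<in> carrier R; x \<in> carrier M; y \<in> carrier M\<rbrakk> \<Longrightarrow>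
       (a \<odot>\<^bsub>M\<^esub> x) \<otimes>\<^bsub>M\<^esub> y = a \<odot>\<^bsub>M\<^esub> (x \<otimes>\<^bsub>M\<^esub> y)"
    and smult_mult_right:
      "\<lbrakk>a \<in> carrier R; x \<in> carrier M; y \<in> carrier M\<rbrakk> \<Longrightarrow>
       x \<otimes>\<^bsub>M\<^esub> (a \<odot>\<^bsub>M\<^esub> y) = a \<odot>\<^bsub>M\<^esub> (x \<otimes>\<^bsub>M\<^esub> y)"

definition SR_algebra ::
    "(quat ^ 'n :: {finite, linorder}) set \<Rightarrow> (real, (quat, 'n) vec \<Rightarrow> quat) module" where
  "SR_algebra \<Omega> = \<lparr>
     carrier = slice_regular \<Omega>,
     mult = star_prod \<Omega>,
     one = restrict (\<lambda>q. 1) \<Omega>,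
     zero = restrict (\<lambda>q. 0) \<Omega>,
     add = (\<lambda>f g. restrict (\<lambda>q. f q + g q) \<Omega>),
     smult = (\<lambda>a f. restrict (\<lambda>q. a *\<^sub>R f q) \<Omega>)\<rparr>"

end

theory Submission
  imports Defs "HOL-Complex_Analysis.Conformal_Mappings"
begin

text \<open>
  Fix a path \<open>\<gamma>\<close> starting at a real point. Along the slices of those units \<open>J\<close> for which the lift of
  \<open>\<gamma>\<close> stays in \<open>\<Omega>\<close>, a slice regular function \<open>g\<close> takes at the end of the lift the value \<open>a + J b\<close>,
  with a pair \<open>(a, b)\<close> that does not depend on \<open>J\<close>. This is the representation formula
  (\<open>representation_formula\<close>): two units determine a candidate for the pair, and for a third unit
  \<open>K\<close> both sides are holomorphic for the complex structure given by left multiplication by \<open>K\<close>,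
  agree at real points, and hence agree all along \<open>\<gamma>\<close> by the identity principle
  (\<open>left_holomorphic_identity\<close>).

  On a self-stem-preserving domain two paths with the same end and a common unit share a second
  unit, so they have the same pair (\<open>stem_along_unique\<close>). Therefore the choices in the definition of
  the product are immaterial, and with \<open>(a, b)\<close> the pair of \<open>g\<close>,
  the value of \<open>f * g\<close> at \<open>q = z\<^sup>I\<close> is \<open>f(q) a + I f(q) b\<close>
  for every path from a real point to \<open>z\<close> whose lift by \<open>I\<close> stays in \<open>\<Omega>\<close> (\<open>star_prod_eval\<close>).
  If \<open>f\<close> has the pair \<open>(c, d)\<close>, then \<open>f * g\<close> has the pair
  \<open>(c a - d b, d a + c b)\<close> (\<open>stem_along_star_prod\<close>). This is the multiplication of
  \<open>c + \<i> d\<close> and \<open>a + \<i> b\<close> in the complexified quaternions, which is associative and bilinear,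
  and the algebra laws follow.

  It remains to see that \<open>f * g\<close> is slice regular (\<open>slice_regular_star_prod\<close>). Near \<open>z\<close> the pair
  of \<open>g\<close> is computed from its values on the slices of two units. As a function of the end point it
  then satisfies the Cauchy-Riemann equations of a pair, and these are what makes the product
  formula holomorphic (\<open>left_holomorphic_row_times_stem\<close>).
\<close>

\<comment> \<open>In the following, \<open>$\<close> always selects a component of a vector.\<close>
no_notation fps_nth (infixl "$" 75)

section \<open>Left holomorphy in several variables and its identity principle\<close>

text \<open>The Cauchy-Riemann equations in all variables together say that the real derivative is
  complex linear for the complex structure \<open>q \<mapsto> K q\<close>. In this form they are stable under
  composition with complex lines and need no coordinates.\<close>

definition left_holomorphic :: "quat \<Rightarrow> (complex ^ 'n :: finite \<Rightarrow> quat) \<Rightarrow> complex ^ 'n \<Rightarrow> bool" where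
  "left_holomorphic K h z \<longleftrightarrow>
     (\<exists>D. (h has_derivative D) (at z) \<and> (\<forall>v. D (\<i> *s v) = K * D v))"

lemma imag_units_square: "I \<in> imag_units \<Longrightarrow> I * I = - 1"
  by (simp add: imag_units_def power2_eq_square)

lemma imag_units_cancel: "I \<in> imag_units \<Longrightarrow> I * (I * q) = - q"
  by (simp add: imag_units_square flip: mult.assoc)

lemma has_derivative_linear_line:
  fixes v :: "complex ^ 'n :: finite"
  shows "((\<lambda>\<zeta>. p + \<zeta> *s v) has_derivative (\<lambda>\<zeta>. \<zeta> *s v)) F"
proof -
  have "linear (\<lambda>\<zeta>. \<zeta> *s v)"
    by (intro linearI) (simp_all add: vec_eq_iff algebra_simps)
  then show ?thesis
    by (auto intro!: derivative_eq_intros bounded_linear_imp_has_derivative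
        simp: linear_conv_bounded_linear)
qed

text \<open>The functional \<open>q \<mapsto> \<langle>c, q\<rangle> - \<i> \<langle>c, K q\<rangle>\<close>
  turns left multiplication by \<open>K\<close> into multiplication by \<open>\<i>\<close>, and its real part
  for \<open>c = q\<close> is \<open>|q|\<^sup>2\<close>.\<close>

definition unit_functional :: "quat \<Rightarrow> quat \<Rightarrow> quat \<Rightarrow> complex" where
  "unit_functional K c q = Complex (inner c q) (- inner c (K * q))"

lemma bounded_linear_unit_functional: "bounded_linear (unit_functional K c)"
proof -
  have "linear (unit_functional K c)"
    by (intro linearI)
      (simp_all add: unit_functional_def complex_eq_iff inner_add_right distrib_left)
  then show ?thesis
    by (simp add: linear_conv_bounded_linear)
qed

lemma unit_functional_mult:
  assumes "K \<in> imag_units"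
  shows "unit_functional K c (K * q) = \<i> * unit_functional K c q"
  using assms by (simp add: unit_functional_def complex_eq_iff imag_units_cancel)

text \<open>Composing with these functionals reduces left holomorphic functions of several variables to
  ordinary holomorphic functions of one complex variable.\<close>

lemma left_holomorphic_along_line:
  assumes K: "K \<in> imag_units" and h: "left_holomorphic K h (p + \<zeta> *s v)"
  shows "(\<lambda>\<zeta>. unit_functional K c (h (p + \<zeta> *s v))) field_differentiable at \<zeta>"
proof -
  obtain D where D: "(h has_derivative D) (at (p + \<zeta> *s v))"
    and DK: "\<And>u. D (\<i> *s u) = K * D u"
    using h by (auto simp: left_holomorphic_def)
  define L where "L = (\<lambda>\<zeta>. unit_functional K c (D (\<zeta> *s v)))"
  have der: "((\<lambda>\<zeta>. unit_functional K c (h (p + \<zeta> *s v))) has_derivative L) (at \<zeta>)"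
    unfolding L_def
    by (rule bounded_linear.has_derivative[OF bounded_linear_unit_functional])
      (rule has_derivative_compose[OF has_derivative_linear_line D])
  then have lin: "linear L"
    by (rule has_derivative_linear)
  have "L \<xi> = L 1 * \<xi>" for \<xi>
  proof -
    have "L \<i> = \<i> * L 1"
      unfolding L_def using DK[of v] by (simp add: unit_functional_mult[OF K])
    moreover have "L \<xi> = L (Re \<xi> *\<^sub>R 1 + Im \<xi> *\<^sub>R \<i>)"
      by (rule arg_cong[where f = L]) (simp add: complex_eq_iff)
    ultimately have "L \<xi> = Re \<xi> *\<^sub>R L 1 + Im \<xi> *\<^sub>R (\<i> * L 1)"
      by (simp only: linear_add[OF lin] linear_scale[OF lin])
    also have "\<dots> = L 1 * (of_real (Re \<xi>) + \<i> * of_real (Im \<xi>))"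
      by (simp add: scaleR_conv_of_real algebra_simps)
    finally show ?thesis
      by (simp flip: complex_eq)
  qed
  then have "L = (*) (L 1)"
    by (intro ext)
  then show ?thesis
    using der unfolding field_differentiable_def has_field_derivative_def by (intro exI[of _ "L 1"]) simp
qed

text \<open>Vanishing at small real parameters suffices for both uses of the one-variable identity
  theorem: the real points of a complex line through a real point, and an open set of zeros.\<close>

lemma left_holomorphic_zero_along_line:
  fixes h :: "complex ^ 'n :: finite \<Rightarrow> quat"
  assumes K: "K \<in> imag_units" and V: "open V" "convex V"
    and h: "\<And>z. z \<in> V \<Longrightarrow> left_holomorphic K h z"
    and p: "p \<in> V" and "0 < e"
    and zero: "\<And>t::real. \<bar>t\<bar> < e \<Longrightarrow> p + of_real t *s v \<in> V \<Longrightarrow> h (p + of_real t *s v) = 0"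
    and w: "p + \<zeta> *s v \<in> V"
  shows "h (p + \<zeta> *s v) = 0"
proof -
  define Z where "Z = (\<lambda>\<zeta>. p + \<zeta> *s v) -` V"
  \<comment> \<open>With this \<open>c\<close>, the real part of the functional at the point in question is the squared norm.\<close>
  define c where "c = h (p + \<zeta> *s v)"
  have cont: "continuous_on UNIV (\<lambda>\<zeta>. p + \<zeta> *s v)"
    by (rule has_derivative_continuous_on) (rule has_derivative_linear_line)
  have "open Z"
    unfolding Z_def by (rule open_vimage[OF V(1) cont])
  have "convex Z"
  proof (rule convexI)
    fix x y :: complex and a b :: real
    assume *: "x \<in> Z" "y \<in> Z" "0 \<le> a" "0 \<le> b" "a + b = 1"
    have "p + (a *\<^sub>R x + b *\<^sub>R y) *s v = (a + b) *\<^sub>R p + (a *\<^sub>R x + b *\<^sub>R y) *s v"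
      using * by simp
    also have "\<dots> = a *\<^sub>R (p + x *s v) + b *\<^sub>R (p + y *s v)"
      by (simp add: vec_eq_iff algebra_simps)
    also have "\<dots> \<in> V"
      using * convexD[OF V(2)] by (simp add: Z_def)
    finally show "a *\<^sub>R x + b *\<^sub>R y \<in> Z"
      by (simp add: Z_def)
  qed
  have "unit_functional K c (h (p + \<zeta> *s v)) = 0"
  proof (rule analytic_continuation[where S = Z and U = "complex_of_real ` {-e<..<e} \<inter> Z"
        and \<xi> = 0 and f = "\<lambda>\<zeta>. unit_functional K c (h (p + \<zeta> *s v))"])
    show "(\<lambda>\<zeta>. unit_functional K c (h (p + \<zeta> *s v))) holomorphic_on Z"
      unfolding holomorphic_on_def
      using left_holomorphic_along_line[OF K h] field_differentiable_at_within
      by (fastforce simp: Z_def)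
    show "0 \<in> Z" using p by (simp add: Z_def)
    then obtain d where d: "0 < d" "ball 0 d \<subseteq> Z"
      using \<open>open Z\<close> open_contains_ball by blast
    show "0 islimpt complex_of_real ` {-e<..<e} \<inter> Z"
      unfolding islimpt_approachable
    proof (intro allI impI)
      fix r :: real assume "0 < r"
      define t where "t = min r (min d e) / 2"
      have t: "0 < t" "t < r" "t < d" "t < e"
        using \<open>0 < r\<close> \<open>0 < e\<close> d by (auto simp: t_def)
      then have "complex_of_real t \<in> Z"
        using d by (auto simp: dist_norm)
      with t show "\<exists>x'\<in>complex_of_real ` {-e<..<e} \<inter> Z. x' \<noteq> 0 \<and> dist x' 0 < r"
        by (intro bexI[of _ "complex_of_real t"]) auto
    qed
    show "unit_functional K c (h (p + z *s v)) = 0" if z: "z \<in> complex_of_real ` {-e<..<e} \<inter> Z" for z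
    proof -
      obtain t where t: "z = of_real t" "\<bar>t\<bar> < e"
        using z by auto
      then have "h (p + z *s v) = 0"
        using zero[of t] z by (auto simp: Z_def)
      then show ?thesis
        by (simp add: unit_functional_def complex_eq_iff)
    qed
  qed (use \<open>open Z\<close> \<open>convex Z\<close> w in \<open>auto simp: Z_def convex_connected\<close>)
  then show ?thesis
    by (simp add: unit_functional_def complex_eq_iff c_def)
qed

text \<open>Around a real point, every \<open>z = a + \<i> b\<close> lies on the complex line through the real point \<open>a\<close>
  in the real direction \<open>b\<close>, whose real parameters give real points; so the function vanishes on a
  ball. From there the set of interior zeros propagates along the connected set, since it meets a
  ball inside \<open>V\<close> only if it contains that ball.\<close>

lemma left_holomorphic_identity:
  fixes h :: "complex ^ 'n :: finite \<Rightarrow> quat"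
  assumes K: "K \<in> imag_units" and V: "open V"
    and h: "\<And>z. z \<in> V \<Longrightarrow> left_holomorphic K h z"
    and zero: "\<And>z. z \<in> V \<Longrightarrow> (\<forall>l. z $ l \<in> \<real>) \<Longrightarrow> h z = 0"
    and C: "connected C" "C \<subseteq> V" and x: "x \<in> C" "\<forall>l. x $ l \<in> \<real>" and y: "y \<in> C"
  shows "h y = 0"
proof -
  define W where "W = interior {z. h z = 0}"
  have W: "x \<in> W"
  proof -
    obtain r where r: "0 < r" "ball x r \<subseteq> V"
      using openE[OF V, of x] C(2) x(1) by auto
    have "h z = 0" if z: "z \<in> ball x r" for z
    proof -
      define a b :: "complex ^ 'n" where
        "a = (\<chi> l. of_real (Re (z $ l)))" and "b = (\<chi> l. of_real (Im (z $ l)))"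
      have zab: "z = a + \<i> *s b"
        by (simp add: vec_eq_iff a_def b_def complex_eq_iff)
      \<comment> \<open>Because \<open>x\<close> is real, passing to real parts does not increase the distance to \<open>x\<close>, so \<open>a\<close> is still in the ball.\<close>
      have "norm ((x - a) $ l) \<le> norm ((x - z) $ l)" for l
      proof -
        have "(x - a) $ l = of_real (Re ((x - z) $ l))"
          using x(2) by (auto simp: a_def complex_eq_iff complex_is_Real_iff)
        then show ?thesis
          using abs_Re_le_cmod[of "(x - z) $ l"] by (simp only: norm_of_real)
      qed
      then have "norm (x - a) \<le> norm (x - z)"
        unfolding norm_vec_def by (intro L2_set_mono) auto
      then have a: "a \<in> ball x r"
        using z by (simp add: dist_norm)
      show ?thesis
        unfolding zab
      proof (rule left_holomorphic_zero_along_line[OF K, where V = "ball x r" and e = 1])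
        show "h (a + of_real t *s b) = 0" if "a + of_real t *s b \<in> ball x r" for t :: real
          using that r(2) by (intro zero) (auto simp: a_def b_def)
        show "left_holomorphic K h z" if "z \<in> ball x r" for z
          using that r(2) h by blast
        show "a + \<i> *s b \<in> ball x r"
          using z unfolding zab .
      qed (use a in simp_all)
    qed
    then show ?thesis
      using r(1) unfolding W_def mem_interior by (auto simp: subset_iff)
  qed
  have "y \<in> W"
  proof (rule connected_induction_simple[where S = C and a = x and P = "\<lambda>z. z \<in> W"])
    fix a assume "a \<in> C"
    then obtain r where r: "0 < r" "ball a r \<subseteq> V"
      using openE[OF V, of a] C(2) by auto
    have *: "z \<in> W" if u: "u \<in> ball a r" "u \<in> W" and z: "z \<in> ball a r" for u z
    proof -
      obtain d where d: "0 < d" "ball u d \<subseteq> {z. h z = 0}"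
        using u unfolding W_def mem_interior by auto
      have "h q = 0" if q: "q \<in> ball a r" for q
      proof -
        have eq: "q = u + 1 *s (q - u)"
          by (simp add: vec_eq_iff)
        show ?thesis
        proof (subst eq, rule left_holomorphic_zero_along_line[OF K,
              where V = "ball a r" and e = "d / (1 + norm (q - u))"])
          fix t :: real assume t: "\<bar>t\<bar> < d / (1 + norm (q - u))"
          have "of_real t *s (q - u) = t *\<^sub>R (q - u)"
            by (simp add: vec_eq_iff scaleR_conv_of_real[where 'a = complex] algebra_simps)
          moreover have "\<bar>t\<bar> * norm (q - u) \<le> \<bar>t\<bar> * (1 + norm (q - u))"
            by (intro mult_left_mono) auto
          moreover have "\<bar>t\<bar> * (1 + norm (q - u)) < d"
            using t norm_ge_zero[of "q - u"] by (subst (asm) pos_less_divide_eq) (linarith, simp)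
          ultimately have "u + of_real t *s (q - u) \<in> ball u d"
            by (simp add: dist_norm)
          then show "h (u + of_real t *s (q - u)) = 0"
            using d(2) by blast
        next
          show "0 < d / (1 + norm (q - u))"
            using d(1) by (simp add: add_pos_nonneg)
        next
          show "left_holomorphic K h z" if "z \<in> ball a r" for z
            using that r(2) h by blast
          show "u + 1 *s (q - u) \<in> ball a r"
            using q unfolding eq[symmetric] .
        qed (use u in simp_all)
      qed
      then show ?thesis
        unfolding W_def using z by (intro interiorI[of "ball a r"]) auto
    qed
    show "\<exists>T. openin (top_of_set C) T \<and> a \<in> T \<and> (\<forall>x\<in>T. \<forall>y\<in>T. x \<in> W \<longrightarrow> y \<in> W)"
    proof (intro exI conjI ballI impI)
      show "openin (top_of_set C) (C \<inter> ball a r)"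
        by (simp add: openin_open_Int)
      show "a \<in> C \<inter> ball a r"
        using \<open>a \<in> C\<close> r(1) by simp
      show "v \<in> W" if "u \<in> C \<inter> ball a r" "v \<in> C \<inter> ball a r" "u \<in> W" for u v
        using that *[of u v] by simp
    qed
  qed (use C x y W in simp_all)
  then show ?thesis
    using interior_subset[of "{z. h z = 0}"] by (auto simp: W_def)
qed

section \<open>Slice regularity in terms of left holomorphy\<close>

lemma slice_lift_nth: "slice_lift I z $ l = of_real (Re (z $ l)) + of_real (Im (z $ l)) * I"
  by (simp add: slice_lift_def)

lemma linear_slice_lift: "linear (slice_lift I)"
  by (intro linearI) (simp_all add: vec_eq_iff slice_lift_nth scaleR_conv_of_real[where 'a = quat] algebra_simps)

lemma bounded_linear_slice_lift: "bounded_linear (slice_lift I)"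
  by (rule linear_conv_bounded_linear[THEN iffD1, OF linear_slice_lift])

lemma range_slice_lift: "range (slice_lift I) = cplx_space I"
proof (intro equalityI subsetI)
  fix q :: "quat ^ 'n" assume "q \<in> cplx_space I"
  then have "\<forall>l. \<exists>a b. q $ l = of_real a + of_real b * I"
    by (auto simp: cplx_space_def cplx_plane_def)
  then obtain a b where "\<And>l. q $ l = of_real (a l) + of_real (b l) * I"
    by metis
  then have "q = slice_lift I (\<chi> l. Complex (a l) (b l))"
    by (simp add: vec_eq_iff slice_lift_nth)
  then show "q \<in> range (slice_lift I)"
    by blast
next
  fix q :: "quat ^ 'n" assume "q \<in> range (slice_lift I)"
  then show "q \<in> cplx_space I"
    by (clarsimp simp: cplx_space_def cplx_plane_def slice_lift_nth) blast
qed

lemma slice_lift_in_cplx_space: "slice_lift I z \<in> cplx_space I"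
  by (metis range_slice_lift rangeI)

lemma of_real_unit_eq_iff:
  assumes "I \<in> imag_units"
  shows "of_real a + of_real b * I = of_real c + of_real d * I \<longleftrightarrow> a = c \<and> b = d"
proof
  assume eq: "of_real a + of_real b * I = of_real c + of_real d * I"
  then have *: "of_real (b - d) * I = of_real (c - a)"
    by (simp add: algebra_simps)
  then have "(of_real (b - d) * I) * (of_real (b - d) * I) = of_real ((c - a)\<^sup>2)"
    by (simp add: power2_eq_square)
  moreover have "(of_real (b - d) * I) * (of_real (b - d) * I) = of_real (- (b - d)\<^sup>2)"
  proof -
    have "of_real (b - d) * I = (b - d) *\<^sub>R I"
      by (simp only: scaleR_conv_of_real)
    then have "(of_real (b - d) * I) * (of_real (b - d) * I) = ((b - d) * (b - d)) *\<^sub>R (I * I)"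
      by simp
    then show ?thesis
      by (simp add: imag_units_square[OF assms] power2_eq_square of_real_def)
  qed
  ultimately have "- (b - d)\<^sup>2 = (c - a)\<^sup>2"
    by (metis of_real_eq_iff)
  then have "b - d = 0 \<and> c - a = 0"
    by (smt (verit) zero_le_power2 power2_eq_iff_nonneg zero_eq_power2)
  then show "a = c \<and> b = d"
    by simp
qed simp

lemma inj_slice_lift:
  assumes "I \<in> imag_units"
  shows "inj (slice_lift I)"
  by (rule injI) (simp add: vec_eq_iff slice_lift_nth of_real_unit_eq_iff[OF assms] complex_eq_iff)

lemma open_slice_preimage:
  assumes "openin slice_topology \<Omega>" "I \<in> imag_units"
  shows "open {z. slice_lift I z \<in> \<Omega>}"
proof -
  have "openin (top_of_set (cplx_space I)) (\<Omega> \<inter> cplx_space I)"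
    using assms by (simp add: openin_slice_topology)
  then obtain T where T: "open T" "\<Omega> \<inter> cplx_space I = cplx_space I \<inter> T"
    by (auto simp: openin_open)
  have "{z. slice_lift I z \<in> \<Omega>} = slice_lift I -` T"
    using T(2) range_slice_lift[of I] by blast
  then show ?thesis
    using open_vimage[OF T(1) linear_continuous_on[OF bounded_linear_slice_lift]] by simp
qed

text \<open>A linear left inverse of the lift transports differentiability back to the slice.\<close>

lemma differentiable_on_slice_iff:
  fixes \<Omega> :: "(quat ^ 'n :: finite) set"
  assumes "openin slice_topology \<Omega>" and I: "I \<in> imag_units"
  shows "f differentiable_on (\<Omega> \<inter> cplx_space I) \<longleftrightarrow>
     (\<forall>z. slice_lift I z \<in> \<Omega> \<longrightarrow> (\<lambda>w. f (slice_lift I w)) differentiable at z)"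
    (is "?L \<longleftrightarrow> ?R")
proof -
  define U where "U = {z. slice_lift I z \<in> \<Omega>}"
  have "open U"
    unfolding U_def by (rule open_slice_preimage[OF assms])
  have im: "slice_lift I ` U = \<Omega> \<inter> cplx_space I"
    by (auto simp: U_def simp flip: range_slice_lift)
  have ?R if L: ?L
  proof (intro allI impI)
    fix z assume z: "slice_lift I z \<in> \<Omega>"
    then have "f differentiable (at (slice_lift I z) within slice_lift I ` U)"
      using L slice_lift_in_cplx_space by (auto simp: differentiable_on_def im)
    moreover have "slice_lift I differentiable (at z within U)"
      by (intro bounded_linear_imp_differentiable bounded_linear_slice_lift)
    ultimately have "(f \<circ> slice_lift I) differentiable (at z within U)"
      by (rule differentiable_chain_within[rotated])
    moreover have "at z within U = at z"
      using z \<open>open U\<close> by (intro at_within_open) (simp add: U_def)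
    ultimately show "(\<lambda>w. f (slice_lift I w)) differentiable at z"
      by (simp add: o_def)
  qed
  moreover have ?L if R: ?R
  proof -
    obtain g where g: "linear g" "g \<circ> slice_lift I = (id :: complex ^ 'n \<Rightarrow> complex ^ 'n)"
      using linear_injective_left_inverse[OF linear_slice_lift inj_slice_lift[OF I]] by blast
    have gl: "g (slice_lift I z) = z" for z
      using fun_cong[OF g(2), of z] by simp
    have "f differentiable (at q within \<Omega> \<inter> cplx_space I)" if q: "q \<in> \<Omega> \<inter> cplx_space I" for q
    proof -
      have "q \<in> slice_lift I ` U"
        using q im by simp
      then obtain z where z: "q = slice_lift I z" "z \<in> U"
        by (rule imageE)
      have "(\<lambda>w. f (slice_lift I w)) differentiable at (g q)"
        using R z by (simp add: gl U_def)
      then have "((\<lambda>w. f (slice_lift I w)) \<circ> g) differentiable (at q within \<Omega> \<inter> cplx_space I)"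
        by (rule differentiable_chain_within[OF linear_imp_differentiable[OF g(1)]
              differentiable_at_withinI])
      then obtain D where
        "((\<lambda>w. f (slice_lift I w)) \<circ> g has_derivative D) (at q within \<Omega> \<inter> cplx_space I)"
        by (auto simp: differentiable_def)
      then have "(f has_derivative D) (at q within \<Omega> \<inter> cplx_space I)"
      proof (rule has_derivative_transform[OF q, rotated])
        fix y assume "y \<in> \<Omega> \<inter> cplx_space I"
        then have "y \<in> slice_lift I ` U"
          using im by simp
        then show "f y = ((\<lambda>w. f (slice_lift I w)) \<circ> g) y"
          by (auto simp: gl)
      qed
      then show ?thesis
        by (auto simp: differentiable_def)
    qed
    then show ?L
      by (simp add: differentiable_on_def)
  qed
  ultimately show ?thesis
    by blast
qed

lemma partial_derivatives:
  fixes h :: "complex ^ 'n :: finite \<Rightarrow> quat"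
  assumes D: "(h has_derivative D) (at z)"
  shows "partial_x l h z = D (axis l 1)" "partial_y l h z = D (axis l \<i>)"
proof -
  have "vector_derivative (\<lambda>t. h (z + axis l (of_real t * c))) (at 0) = D (axis l c)" for c
  proof (rule vector_derivative_at)
    have eq: "axis l (of_real t * c) = t *\<^sub>R axis l c" for t
      by (simp add: vec_eq_iff axis_def scaleR_conv_of_real[where 'a = complex])
    have "((\<lambda>t. z + t *\<^sub>R axis l c) has_derivative (\<lambda>t. t *\<^sub>R axis l c)) (at 0)"
      by (auto intro!: derivative_eq_intros)
    from has_derivative_compose[OF this, of h D] D
    have "((\<lambda>t. h (z + t *\<^sub>R axis l c)) has_derivative (\<lambda>t. D (t *\<^sub>R axis l c))) (at 0)"
      by simp
    then show "((\<lambda>t. h (z + axis l (of_real t * c))) has_vector_derivative D (axis l c)) (at 0)"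
      unfolding has_vector_derivative_def eq
      by (simp add: linear_scale[OF has_derivative_linear[OF D]])
  qed
  from this[of 1] this[of \<i>]
  show "partial_x l h z = D (axis l 1)" "partial_y l h z = D (axis l \<i>)"
    by (simp_all add: partial_x_def partial_y_def)
qed

text \<open>By real linearity it suffices to test complex linearity on the real basis of the vectors
  \<open>axis l 1\<close> and \<open>axis l \<i>\<close>; multiplying by \<open>I\<close> shows that the two tests at \<open>l\<close> coincide.\<close>

lemma left_linear_iff_axes:
  fixes D :: "complex ^ 'n :: finite \<Rightarrow> quat"
  assumes D: "linear D" and I: "I \<in> imag_units"
  shows "(\<forall>v. D (\<i> *s v) = I * D v) \<longleftrightarrow> (\<forall>l. D (axis l 1) + I * D (axis l \<i>) = 0)"
    (is "?L \<longleftrightarrow> ?R")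
proof -
  have ax: "\<i> *s axis l 1 = (axis l \<i> :: complex ^ 'n)" "\<i> *s axis l \<i> = (- axis l 1 :: complex ^ 'n)" for l
    by (simp_all add: vec_eq_iff axis_def)
  have CR: "D (axis l 1) + I * D (axis l \<i>) = 0 \<longleftrightarrow> D (axis l \<i>) = I * D (axis l 1)" for l
  proof
    assume "D (axis l 1) + I * D (axis l \<i>) = 0"
    then have "D (axis l 1) = - (I * D (axis l \<i>))"
      by (simp add: eq_neg_iff_add_eq_0)
    then show "D (axis l \<i>) = I * D (axis l 1)"
      by (simp add: imag_units_cancel[OF I])
  qed (simp add: imag_units_cancel[OF I])
  show ?thesis
  proof
    assume ?L
    then show ?R
      by (metis ax(1) CR)
  next
    assume R: ?R
    have "(\<lambda>v. D (\<i> *s v)) = (\<lambda>v. I * D v)"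
    proof (rule linear_eq_stdbasis)
      have "linear (\<lambda>v :: complex ^ 'n. \<i> *s v)"
        by (intro linearI) (simp_all add: vec_eq_iff algebra_simps)
      then show "linear (\<lambda>v. D (\<i> *s v))"
        using linear_compose[OF _ D] by (simp add: o_def)
      show "linear (\<lambda>v. I * D v)"
        by (intro linearI) (simp_all add: linear_add[OF D] linear_scale[OF D] distrib_left)
      fix b :: "complex ^ 'n" assume "b \<in> Basis"
      then obtain l where "b = axis l 1 \<or> b = axis l \<i>"
        by (auto simp: Basis_vec_def Basis_complex_def)
      then show "D (\<i> *s b) = I * D b"
        using R CR[of l] by (auto simp: ax linear_neg[OF D] imag_units_cancel[OF I])
    qed
    then show ?L
      by (simp add: fun_eq_iff)
  qed
qed

lemma slice_regular_iff:
  fixes \<Omega> :: "(quat ^ 'n :: finite) set"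
  assumes "openin slice_topology \<Omega>"
  shows "f \<in> slice_regular \<Omega> \<longleftrightarrow> f \<in> extensional \<Omega> \<and>
     (\<forall>I\<in>imag_units. \<forall>z. slice_lift I z \<in> \<Omega> \<longrightarrow> left_holomorphic I (\<lambda>w. f (slice_lift I w)) z)"
proof -
  have CR: "left_holomorphic I h z \<longleftrightarrow> h differentiable at z \<and>
      (\<forall>l. (1/2) *\<^sub>R (partial_x l h z + I * partial_y l h z) = 0)" (is "?L \<longleftrightarrow> ?R")
    if I: "I \<in> imag_units" for I z and h :: "complex ^ 'n \<Rightarrow> quat"
  proof
    assume ?L
    then obtain D where D: "(h has_derivative D) (at z)" "\<forall>v. D (\<i> *s v) = I * D v"
      by (auto simp: left_holomorphic_def)
    then show ?R
      using left_linear_iff_axes[OF has_derivative_linear[OF D(1)] I]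
      by (auto simp: partial_derivatives[OF D(1)] differentiable_def)
  next
    assume R: ?R
    then obtain D where D: "(h has_derivative D) (at z)"
      by (auto simp: differentiable_def)
    then show ?L
      using R left_linear_iff_axes[OF has_derivative_linear[OF D] I]
      by (auto simp: partial_derivatives[OF D] left_holomorphic_def)
  qed
  have "f differentiable_on (\<Omega> \<inter> cplx_space I) \<and>
      (\<forall>z l. slice_lift I z \<in> \<Omega> \<longrightarrow>
        (1/2) *\<^sub>R (partial_x l (\<lambda>w. f (slice_lift I w)) z
                  + I * partial_y l (\<lambda>w. f (slice_lift I w)) z) = 0) \<longleftrightarrow>
      (\<forall>z. slice_lift I z \<in> \<Omega> \<longrightarrow> left_holomorphic I (\<lambda>w. f (slice_lift I w)) z)"
    if I: "I \<in> imag_units" for I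
    unfolding differentiable_on_slice_iff[OF assms I] CR[OF I] by blast
  then show ?thesis
    unfolding slice_regular_def mem_Collect_eq by (intro conj_cong[OF refl] ball_cong[OF refl])
qed

section \<open>Stem pairs\<close>

text \<open>These are the Cauchy-Riemann equations for \<open>G1 + \<i> G2\<close> as a function with values in the
  complexified quaternions.\<close>

definition stem_holomorphic ::
    "(complex ^ 'n :: finite \<Rightarrow> quat) \<Rightarrow> (complex ^ 'n \<Rightarrow> quat) \<Rightarrow> complex ^ 'n \<Rightarrow> bool" where
  "stem_holomorphic G1 G2 z \<longleftrightarrow>
     (\<exists>D1 D2. (G1 has_derivative D1) (at z) \<and> (G2 has_derivative D2) (at z) \<and>
        (\<forall>v. D1 (\<i> *s v) = - D2 v \<and> D2 (\<i> *s v) = D1 v))"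

text \<open>For \<open>I \<noteq> J\<close>, the following two functions give the solution of the linear system
  \<open>a + I b = p\<close>, \<open>a + J b = q\<close>.\<close>

definition stem_im :: "quat \<Rightarrow> quat \<Rightarrow> quat \<Rightarrow> quat \<Rightarrow> quat" where
  "stem_im I J p q = inverse (I - J) * (p - q)"

definition stem_re :: "quat \<Rightarrow> quat \<Rightarrow> quat \<Rightarrow> quat \<Rightarrow> quat" where
  "stem_re I J p q = p - I * stem_im I J p q"

lemma stem_pair_eq_iff:
  assumes "I \<noteq> J"
  shows "a + I * b = p \<and> a + J * b = q \<longleftrightarrow> a = stem_re I J p q \<and> b = stem_im I J p q"
proof
  assume pq: "a + I * b = p \<and> a + J * b = q"
  then have "(I - J) * b = p - q"
    by (auto simp: algebra_simps)
  then have "stem_im I J p q = inverse (I - J) * ((I - J) * b)"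
    by (simp add: stem_im_def)
  also have "\<dots> = b"
    using assms by (simp flip: mult.assoc)
  finally have "b = stem_im I J p q" ..
  then show "a = stem_re I J p q \<and> b = stem_im I J p q"
    using pq by (simp add: stem_re_def eq_diff_eq)
next
  assume ab: "a = stem_re I J p q \<and> b = stem_im I J p q"
  have "(I - J) * stem_im I J p q = p - q"
    using assms by (simp add: stem_im_def flip: mult.assoc)
  then have diff: "I * stem_im I J p q - J * stem_im I J p q = p - q"
    by (simp add: left_diff_distrib)
  have "a + J * b = p - (I * stem_im I J p q - J * stem_im I J p q)"
    using ab by (simp add: stem_re_def)
  then show "a + I * b = p \<and> a + J * b = q"
    unfolding diff using ab by (simp add: stem_re_def)
qed

lemma stem_pair_unique:
  fixes I J a b c d :: quat
  assumes "I \<noteq> J" "a + I * b = c + I * d" "a + J * b = c + J * d"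
  shows "a = c" "b = d"
proof -
  have "a = stem_re I J (a + I * b) (a + J * b) \<and> b = stem_im I J (a + I * b) (a + J * b)"
    using stem_pair_eq_iff[OF assms(1)] by blast
  moreover have "c = stem_re I J (a + I * b) (a + J * b) \<and> d = stem_im I J (a + I * b) (a + J * b)"
    using stem_pair_eq_iff[OF assms(1), of c d "a + I * b" "a + J * b"] assms(2,3) by simp
  ultimately show "a = c" "b = d"
    by simp_all
qed

text \<open>Differentiating \<open>G1 + I G2 = f\<close> and \<open>G1 + J G2 = g\<close> in the direction \<open>\<i> v\<close> shows that
  \<open>(- D2 v, D1 v)\<close> and \<open>(D1 (\<i> v), D2 (\<i> v))\<close> solve the same two-unit system, so they are equal.\<close>

lemma stem_holomorphic_from_two_units:
  assumes I: "I \<in> imag_units" and J: "J \<in> imag_units" and "I \<noteq> J"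
    and f: "left_holomorphic I f z" and g: "left_holomorphic J g z"
  shows "stem_holomorphic (\<lambda>w. stem_re I J (f w) (g w)) (\<lambda>w. stem_im I J (f w) (g w)) z"
proof -
  obtain Df where Df: "(f has_derivative Df) (at z)" "\<And>v. Df (\<i> *s v) = I * Df v"
    using f by (auto simp: left_holomorphic_def)
  obtain Dg where Dg: "(g has_derivative Dg) (at z)" "\<And>v. Dg (\<i> *s v) = J * Dg v"
    using g by (auto simp: left_holomorphic_def)
  define D1 where "D1 v = stem_re I J (Df v) (Dg v)" for v
  define D2 where "D2 v = stem_im I J (Df v) (Dg v)" for v
  note mult_left = bounded_linear.has_derivative[OF bounded_linear_mult_right]
  have D2: "((\<lambda>w. stem_im I J (f w) (g w)) has_derivative D2) (at z)"
    unfolding D2_def stem_im_def by (intro mult_left has_derivative_diff Df(1) Dg(1))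
  have D1: "((\<lambda>w. stem_re I J (f w) (g w)) has_derivative D1) (at z)"
    unfolding D1_def stem_re_def
    by (intro mult_left has_derivative_diff Df(1) D2[unfolded D2_def])
  have "D1 (\<i> *s v) = - D2 v \<and> D2 (\<i> *s v) = D1 v" for v
  proof -
    have "D1 v + I * D2 v = Df v" "D1 v + J * D2 v = Dg v"
      using stem_pair_eq_iff[OF \<open>I \<noteq> J\<close>, of "D1 v" "D2 v" "Df v" "Dg v"]
      by (simp_all add: D1_def D2_def)
    then have "- D2 v + I * D1 v = Df (\<i> *s v)" "- D2 v + J * D1 v = Dg (\<i> *s v)"
      by (simp_all add: Df(2) Dg(2) distrib_left imag_units_cancel[OF I] imag_units_cancel[OF J]
          flip: \<open>D1 v + I * D2 v = Df v\<close> \<open>D1 v + J * D2 v = Dg v\<close>)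
    then have "- D2 v = D1 (\<i> *s v) \<and> D1 v = D2 (\<i> *s v)"
      using stem_pair_eq_iff[OF \<open>I \<noteq> J\<close>, of "- D2 v" "D1 v" "Df (\<i> *s v)" "Dg (\<i> *s v)"]
      by (simp add: D1_def[of "\<i> *s v"] D2_def[of "\<i> *s v"])
    then show ?thesis
      by simp
  qed
  then show ?thesis
    using D1 D2 unfolding stem_holomorphic_def by blast
qed

text \<open>In the direction \<open>\<i> v\<close>, the terms of the product rule that differentiate \<open>f\<close> gain a factor \<open>I\<close>
  in front by left holomorphy of \<open>f\<close>. In the other terms \<open>(D1, D2)\<close> turns into \<open>(- D2, D1)\<close>, and
  \<open>f D1 + I f D2\<close> into \<open>- f D2 + I f D1 = I (f D1 + I f D2)\<close>. The constant \<open>f = 1\<close> gives left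
  holomorphy of \<open>G1 + I G2\<close>.\<close>

lemma left_holomorphic_row_times_stem:
  assumes I: "I \<in> imag_units" and f: "left_holomorphic I f z" and G: "stem_holomorphic G1 G2 z"
  shows "left_holomorphic I (\<lambda>w. f w * G1 w + I * f w * G2 w) z"
proof -
  obtain Df where Df: "(f has_derivative Df) (at z)" "\<And>v. Df (\<i> *s v) = I * Df v"
    using f by (auto simp: left_holomorphic_def)
  obtain D1 D2 where D: "(G1 has_derivative D1) (at z)" "(G2 has_derivative D2) (at z)"
      "\<And>v. D1 (\<i> *s v) = - D2 v" "\<And>v. D2 (\<i> *s v) = D1 v"
    using G by (auto simp: stem_holomorphic_def)
  define E where "E v = (f z * D1 v + Df v * G1 z) + (I * f z * D2 v + I * Df v * G2 z)" for v
  have "((\<lambda>w. I * f w) has_derivative (\<lambda>v. I * Df v)) (at z)"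
    by (rule bounded_linear.has_derivative[OF bounded_linear_mult_right Df(1)])
  then have "((\<lambda>w. f w * G1 w + I * f w * G2 w) has_derivative E) (at z)"
    unfolding E_def by (intro has_derivative_add has_derivative_mult Df(1) D(1,2))
  moreover have "E (\<i> *s v) = I * E v" for v
    by (simp add: E_def Df(2) D(3,4) distrib_left mult.assoc imag_units_cancel[OF I])
  ultimately show ?thesis
    unfolding left_holomorphic_def by blast
qed

lemma left_holomorphic_const: "left_holomorphic I (\<lambda>w. c) z"
  unfolding left_holomorphic_def by (intro exI[of _ "\<lambda>v. 0"]) simp

lemma left_holomorphic_add:
  assumes "left_holomorphic I f z" "left_holomorphic I g z"
  shows "left_holomorphic I (\<lambda>w. f w + g w) z"
proof -
  obtain Df Dg where "(f has_derivative Df) (at z)" "\<forall>v. Df (\<i> *s v) = I * Df v"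
      "(g has_derivative Dg) (at z)" "\<forall>v. Dg (\<i> *s v) = I * Dg v"
    using assms by (auto simp: left_holomorphic_def)
  then show ?thesis
    unfolding left_holomorphic_def
    by (intro exI[of _ "\<lambda>v. Df v + Dg v"]) (simp add: has_derivative_add distrib_left)
qed

lemma left_holomorphic_scaleR:
  assumes "left_holomorphic I f z"
  shows "left_holomorphic I (\<lambda>w. a *\<^sub>R f w) z"
proof -
  obtain Df where "(f has_derivative Df) (at z)" "\<forall>v. Df (\<i> *s v) = I * Df v"
    using assms by (auto simp: left_holomorphic_def)
  then show ?thesis
    unfolding left_holomorphic_def
    by (intro exI[of _ "\<lambda>v. a *\<^sub>R Df v"]) (simp add: has_derivative_scaleR_right)
qed

lemma left_holomorphic_transform:
  assumes "left_holomorphic I f z" "open U" "z \<in> U" "\<And>w. w \<in> U \<Longrightarrow> f w = g w"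
  shows "left_holomorphic I g z"
  using assms has_derivative_transform_within_open[of f _ z UNIV U g]
  unfolding left_holomorphic_def by metis

section \<open>Stem values along a path\<close>

lemma path_image_path_lift: "path_image (path_lift I \<gamma>) = slice_lift I ` path_image \<gamma>"
  by (auto simp: path_image_def path_lift_def)

lemma pathfinish_path_lift: "pathfinish (path_lift I \<gamma>) = slice_lift I (pathfinish \<gamma>)"
  by (simp add: pathfinish_def path_lift_def)

lemma path_units_iff:
  "I \<in> path_units \<Omega> \<gamma> \<longleftrightarrow> I \<in> imag_units \<and> (\<forall>z\<in>path_image \<gamma>. slice_lift I z \<in> \<Omega>)"
  by (auto simp: path_units_def path_image_path_lift)

lemma path_units_imag: "I \<in> path_units \<Omega> \<gamma> \<Longrightarrow> I \<in> imag_units"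
  by (simp add: path_units_iff)

lemma path_units_finish: "I \<in> path_units \<Omega> \<gamma> \<Longrightarrow> slice_lift I (pathfinish \<gamma>) \<in> \<Omega>"
  by (simp add: path_units_iff pathfinish_in_path_image)

lemma paths_in_iff: "\<gamma> \<in> paths_in \<Omega> \<longleftrightarrow> \<gamma> \<in> real_start_paths \<and> (\<exists>I. I \<in> path_units \<Omega> \<gamma>)"
  by (auto simp: paths_in_def)

text \<open>The value of a path-slice stem function at \<open>\<gamma>\<close>, as a relation; it need not be unique in
  general.\<close>

definition stem_along ::
    "(quat ^ 'n) set \<Rightarrow> (quat ^ 'n \<Rightarrow> quat) \<Rightarrow> (real \<Rightarrow> complex ^ 'n) \<Rightarrow> quat \<Rightarrow> quat \<Rightarrow> bool" where
  "stem_along \<Omega> g \<gamma> a b \<longleftrightarrow>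
     (\<forall>J\<in>path_units \<Omega> \<gamma>. g (slice_lift J (pathfinish \<gamma>)) = a + J * b)"

lemma slice_lift_real:
  assumes "\<forall>l. z $ l \<in> \<real>"
  shows "slice_lift I z = slice_lift J z"
  using assms by (simp add: vec_eq_iff slice_lift_nth complex_is_Real_iff)

lemma slice_regular_left_holomorphic:
  fixes \<Omega> :: "(quat ^ 'n :: finite) set"
  assumes "openin slice_topology \<Omega>" "f \<in> slice_regular \<Omega>" "I \<in> imag_units" "slice_lift I z \<in> \<Omega>"
  shows "left_holomorphic I (\<lambda>w. f (slice_lift I w)) z"
  using assms(2-) slice_regular_iff[OF assms(1), of f] by simp

lemma restrict_slice_regularI:
  fixes \<Omega> :: "(quat ^ 'n :: finite) set"
  assumes \<Omega>: "openin slice_topology \<Omega>"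
    and h: "\<And>I z. I \<in> imag_units \<Longrightarrow> slice_lift I z \<in> \<Omega> \<Longrightarrow>
      left_holomorphic I (\<lambda>w. h (slice_lift I w)) z"
  shows "restrict h \<Omega> \<in> slice_regular \<Omega>"
  unfolding slice_regular_iff[OF \<Omega>]
proof (intro conjI ballI allI impI)
  fix I and z :: "complex ^ 'n" assume *: "I \<in> imag_units" "slice_lift I z \<in> \<Omega>"
  show "left_holomorphic I (\<lambda>w. restrict h \<Omega> (slice_lift I w)) z"
    by (rule left_holomorphic_transform[OF h[OF *] open_slice_preimage[OF \<Omega> *(1)]]) (use * in simp_all)
qed simp

text \<open>Two units in \<^term>\<open>path_units \<Omega> \<gamma>\<close> determine the only possible pair. For a further unit \<open>K\<close>
  the difference of the two sides is left holomorphic with respect to \<open>K\<close> near \<open>\<gamma>\<close>, and it vanishes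
  at real points, where all slices meet.\<close>

proposition representation_formula:
  fixes \<Omega> :: "(quat ^ 'n :: finite) set"
  assumes \<Omega>: "openin slice_topology \<Omega>" and f: "f \<in> slice_regular \<Omega>"
    and \<gamma>: "\<gamma> \<in> real_start_paths"
  shows "\<exists>a b. stem_along \<Omega> f \<gamma> a b"
proof (cases "\<exists>I\<in>path_units \<Omega> \<gamma>. \<exists>J\<in>path_units \<Omega> \<gamma>. I \<noteq> J")
  case True
  then obtain I J where I: "I \<in> path_units \<Omega> \<gamma>" and J: "J \<in> path_units \<Omega> \<gamma>" and "I \<noteq> J"
    by blast
  define G1 G2 where
    "G1 w = stem_re I J (f (slice_lift I w)) (f (slice_lift J w))" and
    "G2 w = stem_im I J (f (slice_lift I w)) (f (slice_lift J w))" for w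
  have "f (slice_lift K (pathfinish \<gamma>)) = G1 (pathfinish \<gamma>) + K * G2 (pathfinish \<gamma>)"
    if K: "K \<in> path_units \<Omega> \<gamma>" for K
  proof -
    define V where "V = {z. slice_lift I z \<in> \<Omega>} \<inter> {z. slice_lift J z \<in> \<Omega>} \<inter> {z. slice_lift K z \<in> \<Omega>}"
    define h where "h w = f (slice_lift K w) + (-1) *\<^sub>R (1 * G1 w + K * 1 * G2 w)" for w
    note units = path_units_imag[OF I] path_units_imag[OF J] path_units_imag[OF K]
    have "h (pathfinish \<gamma>) = 0"
    proof (rule left_holomorphic_identity[where V = V and C = "path_image \<gamma>" and K = K
          and x = "pathstart \<gamma>"])
      show "open V"
        unfolding V_def by (intro open_Int open_slice_preimage \<Omega> units)
      fix z assume z: "z \<in> V"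
      show "left_holomorphic K h z"
        unfolding h_def G1_def G2_def
        by (intro left_holomorphic_add left_holomorphic_scaleR left_holomorphic_row_times_stem
            left_holomorphic_const stem_holomorphic_from_two_units
            slice_regular_left_holomorphic[OF \<Omega> f] units \<open>I \<noteq> J\<close>)
          (use z in \<open>simp_all add: V_def\<close>)
      assume "\<forall>l. z $ l \<in> \<real>"
      then have "slice_lift I z = slice_lift K z" "slice_lift J z = slice_lift K z"
        by (auto intro: slice_lift_real)
      then show "h z = 0"
        by (simp add: h_def G1_def G2_def stem_re_def stem_im_def)
    next
      show "connected (path_image \<gamma>)" "\<forall>l. pathstart \<gamma> $ l \<in> \<real>"
        using \<gamma> by (auto simp: real_start_paths_def intro: connected_path_image)
      show "path_image \<gamma> \<subseteq> V"
        using I J K by (auto simp: V_def path_units_iff)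
    qed (simp_all add: units pathstart_in_path_image pathfinish_in_path_image)
    moreover have "h w = f (slice_lift K w) - (G1 w + K * G2 w)" for w
      by (simp add: h_def algebra_simps)
    ultimately show ?thesis
      by (simp only: right_minus_eq)
  qed
  then show ?thesis
    unfolding stem_along_def by blast
next
  case False
  show ?thesis
  proof (cases "path_units \<Omega> \<gamma> = {}")
    case True
    then show ?thesis
      by (simp add: stem_along_def)
  next
    case nonempty: False
    then obtain I where "path_units \<Omega> \<gamma> = {I}"
      using False by blast
    then show ?thesis
      by (intro exI[of _ "f (slice_lift I (pathfinish \<gamma>))"] exI[of _ 0]) (simp add: stem_along_def)
  qed
qed

lemma slice_regular_imp_path_slice:
  fixes \<Omega> :: "(quat ^ 'n :: finite) set"
  assumes \<Omega>: "openin slice_topology \<Omega>" and f: "f \<in> slice_regular \<Omega>"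
  shows "f \<in> path_slice \<Omega>"
proof -
  obtain a b where ab: "\<And>\<gamma>. \<gamma> \<in> real_start_paths \<Longrightarrow> stem_along \<Omega> f \<gamma> (a \<gamma>) (b \<gamma>)"
    using representation_formula[OF assms] by metis
  have "is_stem_function \<Omega> f (restrict (\<lambda>\<gamma>. vector [a \<gamma>, b \<gamma>]) (paths_in \<Omega>))"
    unfolding is_stem_function_def
  proof (intro conjI ballI)
    fix \<gamma> I assume "\<gamma> \<in> paths_in \<Omega>" "I \<in> path_units \<Omega> \<gamma>"
    then show "f (pathfinish (path_lift I \<gamma>)) =
        row_times_col 1 I (restrict (\<lambda>\<gamma>. vector [a \<gamma>, b \<gamma>]) (paths_in \<Omega>) \<gamma>)"
      using ab[of \<gamma>]
      by (simp add: row_times_col_def pathfinish_path_lift stem_along_def paths_in_iff)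
  qed simp
  then show ?thesis
    using f by (auto simp: path_slice_def slice_regular_def)
qed

section \<open>Conjugation and the distinguished unit of a point\<close>

text \<open>Every non-real point has two descriptions, as a lift of \<open>z\<close> by \<open>I\<close> and of the conjugate of \<open>z\<close> by
  \<open>- I\<close>. Conjugating paths lets the second be replaced by the first.\<close>

definition cnj_vec :: "complex ^ 'n \<Rightarrow> complex ^ 'n" where
  "cnj_vec z = (\<chi> l. cnj (z $ l))"

lemma slice_lift_cnj_vec: "slice_lift I (cnj_vec z) = slice_lift (- I) z"
  by (simp add: vec_eq_iff slice_lift_nth cnj_vec_def)

lemma cnj_path:
  fixes \<gamma> :: "real \<Rightarrow> complex ^ 'n :: finite"
  assumes "\<gamma> \<in> real_start_paths"
  shows "cnj_vec \<circ> \<gamma> \<in> real_start_paths"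
proof -
  have "continuous_on (path_image \<gamma>) cnj_vec"
    unfolding cnj_vec_def by (intro continuous_intros)
  then show ?thesis
    using assms
    by (auto simp: real_start_paths_def pathstart_compose cnj_vec_def Reals_cnj_iff
        intro: path_continuous_image)
qed

lemma path_units_cnj: "I \<in> path_units \<Omega> (cnj_vec \<circ> \<gamma>) \<longleftrightarrow> - I \<in> path_units \<Omega> \<gamma>"
  by (auto simp: path_units_iff path_image_compose slice_lift_cnj_vec imag_units_def)

lemma stem_along_cnj:
  assumes "stem_along \<Omega> g \<gamma> a b"
  shows "stem_along \<Omega> g (cnj_vec \<circ> \<gamma>) a (- b)"
  using assms
  by (auto simp: stem_along_def path_units_cnj pathfinish_compose slice_lift_cnj_vec)

lemma qre_imag_unit:
  assumes "I \<in> imag_units"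
  shows "qre I = 0"
proof (rule ccontr)
  assume "qre I \<noteq> 0"
  moreover have "qre I * qim1 I = 0" "qre I * qim2 I = 0" "qre I * qim3 I = 0"
      and "qre I * qre I - qim1 I * qim1 I - qim2 I * qim2 I - qim3 I * qim3 I = - 1"
    using imag_units_square[OF assms] by (auto simp: quat_eq_iff times_quat_def)
  ultimately show False
    using zero_le_square[of "qre I"] by auto
qed

lemma norm_imag_unit:
  assumes "I \<in> imag_units"
  shows "norm I = 1"
proof -
  have "norm I * norm I = 1"
    using imag_units_square[OF assms] by (metis norm_minus_cancel norm_mult norm_one)
  then show ?thesis
    by (metis abs_norm_cancel abs_square_eq_1 power2_eq_square)
qed

lemma slice_lift_real_iff:
  assumes I: "I \<in> imag_units"
  shows "slice_lift I z $ l \<in> \<real> \<longleftrightarrow> z $ l \<in> \<real>"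
proof
  assume "slice_lift I z $ l \<in> \<real>"
  then obtain c where "slice_lift I z $ l = of_real c"
    by (auto simp: Reals_def)
  then have "of_real (Re (z $ l)) + of_real (Im (z $ l)) * I = of_real c + of_real 0 * I"
    by (simp add: slice_lift_nth)
  then have "Im (z $ l) = 0"
    unfolding of_real_unit_eq_iff[OF I] by simp
  then show "z $ l \<in> \<real>"
    by (simp add: complex_is_Real_iff)
qed (simp add: slice_lift_nth complex_is_Real_iff)

lemma imag_unit_of_slice_lift:
  fixes z :: "complex ^ 'n :: {finite, linorder}"
  assumes I: "I \<in> imag_units" and z: "\<not> (\<forall>l. z $ l \<in> \<real>)"
  shows "imag_unit_of (slice_lift I z) = I \<or> imag_unit_of (slice_lift I z) = - I"
proof -
  define m where "m = Min {l. slice_lift I z $ l \<notin> \<real>}"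
  define x y where "x = Re (z $ m)" and "y = Im (z $ m)"
  have ne: "{l. slice_lift I z $ l \<notin> \<real>} \<noteq> {}"
    using z by (simp add: slice_lift_real_iff[OF I])
  have "m \<in> {l. slice_lift I z $ l \<notin> \<real>}"
    unfolding m_def by (rule Min_in[OF _ ne]) simp
  then have "y \<noteq> 0"
    by (simp add: slice_lift_real_iff[OF I] complex_is_Real_iff y_def)
  have p: "slice_lift I z $ m = x *\<^sub>R 1 + y *\<^sub>R I"
    by (simp add: slice_lift_nth x_def y_def scaleR_conv_of_real)
  have "qre (slice_lift I z $ m) = x"
    by (simp add: p qre_imag_unit[OF I])
  then have "slice_lift I z $ m - of_real (qre (slice_lift I z $ m)) = y *\<^sub>R I"
    by (simp add: p of_real_def)
  note diff = this
  have not_real: "(\<forall>l. slice_lift I z $ l \<in> \<real>) = False"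
    using z by (simp add: slice_lift_real_iff[OF I])
  have "imag_unit_of (slice_lift I z) = (y *\<^sub>R I) /\<^sub>R norm (y *\<^sub>R I)"
    unfolding imag_unit_of_def not_real if_False Let_def m_def[symmetric] diff ..
  also have "\<dots> = (y / \<bar>y\<bar>) *\<^sub>R I"
    by (simp add: norm_imag_unit[OF I] divide_inverse mult.commute)
  finally show ?thesis
    using \<open>y \<noteq> 0\<close> by (cases "y > 0") auto
qed

section \<open>The product on a self-stem-preserving domain\<close>

context
  fixes \<Omega> :: "(quat ^ 'n :: {finite, linorder}) set"
  assumes \<Omega>: "openin slice_topology \<Omega>" and ssp: "self_stem_preserving \<Omega>"
begin

text \<open>The case \<open>\<alpha> = \<beta>\<close> gives a second unit for a single path.\<close>

lemma other_common_unit: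
  assumes "\<alpha> \<in> real_start_paths" "\<beta> \<in> real_start_paths" "pathfinish \<alpha> = pathfinish \<beta>"
    and I: "I \<in> path_units \<Omega> \<alpha>" "I \<in> path_units \<Omega> \<beta>"
  obtains J where "J \<in> path_units \<Omega> \<alpha>" "J \<in> path_units \<Omega> \<beta>" "J \<noteq> I"
proof -
  have "card (path_units \<Omega> \<alpha> \<inter> path_units \<Omega> \<beta>) \<noteq> 1"
    using assms ssp unfolding self_stem_preserving_def stem_preserving_def
    by (meson paths_in_iff)
  then have "path_units \<Omega> \<alpha> \<inter> path_units \<Omega> \<beta> \<noteq> {I}"
    by auto
  then show ?thesis
    using I that by blast
qed

lemma stem_along_unique:
  assumes \<alpha>: "\<alpha> \<in> real_start_paths" and \<beta>: "\<beta> \<in> real_start_paths"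
    and fin: "pathfinish \<alpha> = pathfinish \<beta>"
    and I: "I \<in> path_units \<Omega> \<alpha>" "I \<in> path_units \<Omega> \<beta>"
    and a: "stem_along \<Omega> g \<alpha> a b" and c: "stem_along \<Omega> g \<beta> c d"
  shows "a = c" "b = d"
proof -
  obtain J where J: "J \<in> path_units \<Omega> \<alpha>" "J \<in> path_units \<Omega> \<beta>" "J \<noteq> I"
    using other_common_unit[OF \<alpha> \<beta> fin I] .
  have "a + K * b = c + K * d" if "K \<in> path_units \<Omega> \<alpha>" "K \<in> path_units \<Omega> \<beta>" for K
    using a c fin that unfolding stem_along_def by metis
  then show "a = c" "b = d"
    using stem_pair_unique[of J I a b c d] J I by blast+
qed

lemma stem_along_stem_function:
  assumes g: "g \<in> path_slice \<Omega>" and \<gamma>: "\<gamma> \<in> paths_in \<Omega>"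
  shows "stem_along \<Omega> g \<gamma> (stem_function \<Omega> g \<gamma> $ 1) (stem_function \<Omega> g \<gamma> $ 2)"
proof -
  have along: "stem_along \<Omega> g \<gamma> (F \<gamma> $ 1) (F \<gamma> $ 2)"
    if "is_stem_function \<Omega> g F" "\<gamma> \<in> paths_in \<Omega>" for F \<gamma>
    using that by (simp add: is_stem_function_def stem_along_def row_times_col_def pathfinish_path_lift)
  obtain F where F: "is_stem_function \<Omega> g F"
    using g by (auto simp: path_slice_def)
  have "is_stem_function \<Omega> g (stem_function \<Omega> g)"
    unfolding stem_function_def
  proof (rule theI[of "is_stem_function \<Omega> g", OF F])
    fix F' assume F': "is_stem_function \<Omega> g F'"
    show "F' = F"
    proof (rule extensionalityI[of _ "paths_in \<Omega>"])
      fix \<gamma> assume \<gamma>: "\<gamma> \<in> paths_in \<Omega>"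
      then obtain I where "\<gamma> \<in> real_start_paths" "I \<in> path_units \<Omega> \<gamma>"
        by (auto simp: paths_in_iff)
      then have "F' \<gamma> $ 1 = F \<gamma> $ 1" "F' \<gamma> $ 2 = F \<gamma> $ 2"
        using stem_along_unique[OF _ _ refl _ _ along[OF F' \<gamma>] along[OF F \<gamma>]] by blast+
      then show "F' \<gamma> = F \<gamma>"
        by (simp add: vec_eq_iff forall_2)
    qed (use F F' in \<open>simp_all add: is_stem_function_def\<close>)
  qed
  then show ?thesis
    using along \<gamma> by blast
qed

text \<open>The definition of the product prescribes the unit \<^term>\<open>imag_unit_of q\<close> and some chosen path.
  The path may be exchanged by uniqueness of the pair, and \<^term>\<open>imag_unit_of q\<close> is \<open>I\<close> or \<open>- I\<close>, where
  in the second case conjugation changes the signs of \<open>I\<close> and \<open>b\<close> simultaneously. At real points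
  all slices meet, so \<open>b = 0\<close> and the formula reduces to the pointwise product.\<close>

lemma star_prod_eval:
  assumes g: "g \<in> path_slice \<Omega>" and \<gamma>: "\<gamma> \<in> real_start_paths" and I: "I \<in> path_units \<Omega> \<gamma>"
    and ab: "stem_along \<Omega> g \<gamma> a b" and q: "q = slice_lift I (pathfinish \<gamma>)"
  shows "star_prod \<Omega> f g q = f q * a + I * f q * b"
proof -
  have I': "I \<in> imag_units" and "q \<in> \<Omega>"
    using I path_units_finish[OF I] by (simp_all add: path_units_iff q)
  have prod: "star_prod \<Omega> f g q =
      f q * point_stem \<Omega> g q $ 1 + imag_unit_of q * f q * point_stem \<Omega> g q $ 2"
    using \<open>q \<in> \<Omega>\<close> by (simp add: star_prod_def row_times_col_def)
  show ?thesis
  proof (cases "\<forall>l. pathfinish \<gamma> $ l \<in> \<real>")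
    case True
    then have real: "\<forall>l. q $ l \<in> \<real>"
      by (simp add: q slice_lift_real_iff[OF I'])
    obtain J where J: "J \<in> path_units \<Omega> \<gamma>" "J \<noteq> I"
      using other_common_unit[OF \<gamma> \<gamma> refl I I] .
    have qJ: "q = slice_lift J (pathfinish \<gamma>)"
      unfolding q by (rule slice_lift_real[OF True])
    have "a + I * b = g q"
      unfolding q using ab I by (simp add: stem_along_def)
    moreover have "a + J * b = g q"
      unfolding qJ using ab J by (simp add: stem_along_def)
    ultimately have "a = g q" "b = 0"
      using stem_pair_unique[OF J(2), of a b "g q" 0] by simp_all
    then show ?thesis
      using real unfolding prod by (simp add: point_stem_def imag_unit_of_def)
  next
    case False
    define U where "U = imag_unit_of q"
    define P where "P \<delta> \<longleftrightarrow> \<delta> \<in> paths_in \<Omega> \<and> path_image (path_lift U \<delta>) \<subseteq> \<Omega> \<and>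
      pathfinish (path_lift U \<delta>) = q" for \<delta>
    have not_real: "(\<forall>l. q $ l \<in> \<real>) = False"
      using False by (simp add: q slice_lift_real_iff[OF I'])
    have stem: "point_stem \<Omega> g q = stem_function \<Omega> g (Eps P)"
      by (simp only: point_stem_def not_real if_False P_def[abs_def] U_def)
    have along_path: "f q * point_stem \<Omega> g q $ 1 + U * f q * point_stem \<Omega> g q $ 2 = f q * c + U * f q * d"
      if \<beta>: "\<beta> \<in> real_start_paths" "U \<in> path_units \<Omega> \<beta>" "slice_lift U (pathfinish \<beta>) = q"
        "stem_along \<Omega> g \<beta> c d" for \<beta> c d
    proof -
      have U: "U \<in> imag_units"
        using \<beta>(2) by (rule path_units_imag)
      have "P \<beta>"
        using \<beta> by (auto simp: P_def paths_in_iff pathfinish_path_lift path_units_def)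
      then have P: "P (Eps P)"
        by (rule someI[of P])
      then have "slice_lift U (pathfinish (Eps P)) = slice_lift U (pathfinish \<beta>)"
        by (simp add: P_def pathfinish_path_lift \<beta>(3))
      then have fin: "pathfinish (Eps P) = pathfinish \<beta>"
        by (rule injD[OF inj_slice_lift[OF U]])
      have "Eps P \<in> paths_in \<Omega>" and E: "Eps P \<in> real_start_paths" and UE: "U \<in> path_units \<Omega> (Eps P)"
        using P U by (simp_all add: P_def paths_in_iff path_units_def)
      then have "stem_along \<Omega> g (Eps P) (point_stem \<Omega> g q $ 1) (point_stem \<Omega> g q $ 2)"
        unfolding stem using stem_along_stem_function[OF g] by blast
      from stem_along_unique[OF E \<beta>(1) fin UE \<beta>(2) this \<beta>(4)]
      show ?thesis
        by simp
    qed
    have "U = I \<or> U = - I"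
      unfolding U_def q by (rule imag_unit_of_slice_lift[OF I' False])
    then show ?thesis
    proof
      assume "U = I"
      then show ?thesis
        using along_path[of \<gamma> a b] \<gamma> I ab q prod by (simp add: U_def)
    next
      assume U: "U = - I"
      have "slice_lift U (pathfinish (cnj_vec \<circ> \<gamma>)) = q"
        by (simp add: pathfinish_compose slice_lift_cnj_vec U q)
      then have "star_prod \<Omega> f g q = f q * a + U * f q * (- b)"
        using along_path[of "cnj_vec \<circ> \<gamma>" a "- b"] cnj_path[OF \<gamma>] stem_along_cnj[OF ab] I prod
        by (simp add: U_def[symmetric] path_units_cnj U)
      then show ?thesis
        by (simp add: U)
    qed
  qed
qed

lemma exists_path:
  assumes "q \<in> \<Omega>"
  obtains \<gamma> I where "\<gamma> \<in> real_start_paths" "I \<in> path_units \<Omega> \<gamma>" "q = slice_lift I (pathfinish \<gamma>)"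
  using assms ssp unfolding self_stem_preserving_def real_path_connected_def
  by (metis paths_in_iff pathfinish_path_lift)

text \<open>Real-path-connectedness provides some unit for the point \<open>z\<^sup>I\<close>. It is \<open>I\<close> up to sign
  unless the point is real, in which case the constant path serves for all units.\<close>

lemma exists_path_in_slice:
  assumes I: "I \<in> imag_units" and z: "slice_lift I z \<in> \<Omega>"
  obtains \<gamma> where "\<gamma> \<in> real_start_paths" "I \<in> path_units \<Omega> \<gamma>" "pathfinish \<gamma> = z"
proof (cases "\<forall>l. z $ l \<in> \<real>")
  case True
  then show ?thesis
    using I z by (intro that[of "linepath z z"]) (auto simp: real_start_paths_def path_units_iff)
next
  case False
  obtain \<gamma> J where \<gamma>: "\<gamma> \<in> real_start_paths" and J: "J \<in> path_units \<Omega> \<gamma>"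
    and q: "slice_lift I z = slice_lift J (pathfinish \<gamma>)"
    using exists_path[OF z] .
  have J': "J \<in> imag_units"
    using J by (rule path_units_imag)
  have "slice_lift I z $ l \<in> \<real> \<longleftrightarrow> pathfinish \<gamma> $ l \<in> \<real>" for l
    unfolding q by (rule slice_lift_real_iff[OF J'])
  then have "\<not> (\<forall>l. pathfinish \<gamma> $ l \<in> \<real>)"
    using False by (simp add: slice_lift_real_iff[OF I])
  then have "I = J \<or> I = - J"
    using imag_unit_of_slice_lift[OF I False] imag_unit_of_slice_lift[OF J', of "pathfinish \<gamma>"]
    unfolding q by (metis minus_minus)
  then show ?thesis
  proof
    assume "I = J"
    then show ?thesis
      using \<gamma> J q injD[OF inj_slice_lift[OF I]] by (intro that[of \<gamma>]) auto
  next
    assume IJ: "I = - J"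
    have "slice_lift I (pathfinish (cnj_vec \<circ> \<gamma>)) = slice_lift I z"
      unfolding q by (simp add: pathfinish_compose slice_lift_cnj_vec IJ)
    then have "pathfinish (cnj_vec \<circ> \<gamma>) = z"
      by (rule injD[OF inj_slice_lift[OF I]])
    then show ?thesis
      using cnj_path[OF \<gamma>] J IJ by (intro that[of "cnj_vec \<circ> \<gamma>"]) (simp_all add: path_units_cnj)
  qed
qed

lemma stem_along_star_prod:
  assumes g: "g \<in> path_slice \<Omega>" and \<gamma>: "\<gamma> \<in> real_start_paths"
    and ab: "stem_along \<Omega> f \<gamma> a b" and cd: "stem_along \<Omega> g \<gamma> c d"
  shows "stem_along \<Omega> (star_prod \<Omega> f g) \<gamma> (a * c - b * d) (b * c + a * d)"
  unfolding stem_along_def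
proof
  fix J assume J: "J \<in> path_units \<Omega> \<gamma>"
  have "star_prod \<Omega> f g (slice_lift J (pathfinish \<gamma>)) = (a + J * b) * c + J * (a + J * b) * d"
    using star_prod_eval[OF g \<gamma> J cd refl, of f] ab J by (simp add: stem_along_def)
  then show "star_prod \<Omega> f g (slice_lift J (pathfinish \<gamma>)) = a * c - b * d + J * (b * c + a * d)"
    using imag_units_cancel[OF path_units_imag[OF J]]
    by (simp add: distrib_left distrib_right left_diff_distrib right_diff_distrib mult.assoc)
qed

text \<open>Extending one path to \<open>z\<close> by short segments keeps two chosen units \<open>I\<close> and \<open>J\<close> admissible. So in
  a ball around \<open>z\<close> the pair of \<open>g\<close> is given by the two-unit formula, which is a
  holomorphic stem pair.\<close>

proposition slice_regular_star_prod:
  assumes f: "f \<in> slice_regular \<Omega>" and g: "g \<in> slice_regular \<Omega>"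
  shows "star_prod \<Omega> f g \<in> slice_regular \<Omega>"
  unfolding slice_regular_iff[OF \<Omega>]
proof (intro conjI ballI allI impI)
  show "star_prod \<Omega> f g \<in> extensional \<Omega>"
    by (simp add: star_prod_def)
  fix I and z :: "(complex, 'n) vec" assume I: "I \<in> imag_units" and z: "slice_lift I z \<in> \<Omega>"
  obtain \<gamma> where \<gamma>: "\<gamma> \<in> real_start_paths" "I \<in> path_units \<Omega> \<gamma>" "pathfinish \<gamma> = z"
    using exists_path_in_slice[OF I z] .
  obtain J where J: "J \<in> path_units \<Omega> \<gamma>" "J \<noteq> I"
    using other_common_unit[OF \<gamma>(1) \<gamma>(1) refl \<gamma>(2) \<gamma>(2)] .
  have J': "J \<in> imag_units" and zJ: "slice_lift J z \<in> \<Omega>"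
    using J(1) path_units_finish[OF J(1)] \<gamma>(3) by (simp_all add: path_units_iff)
  have "open ({w. slice_lift I w \<in> \<Omega>} \<inter> {w. slice_lift J w \<in> \<Omega>})"
    by (intro open_Int open_slice_preimage \<Omega> I J')
  moreover have "z \<in> {w. slice_lift I w \<in> \<Omega>} \<inter> {w. slice_lift J w \<in> \<Omega>}"
    using z zJ by simp
  ultimately obtain r where
    r: "0 < r" "ball z r \<subseteq> {w. slice_lift I w \<in> \<Omega>} \<inter> {w. slice_lift J w \<in> \<Omega>}"
    by (rule openE)
  define G1 G2 where
    "G1 w = stem_re I J (g (slice_lift I w)) (g (slice_lift J w))" and
    "G2 w = stem_im I J (g (slice_lift I w)) (g (slice_lift J w))" for w
  have eq: "f (slice_lift I w) * G1 w + I * f (slice_lift I w) * G2 w = star_prod \<Omega> f g (slice_lift I w)"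
    if w: "w \<in> ball z r" for w
  proof -
    define \<delta> where "\<delta> = \<gamma> +++ linepath z w"
    have "closed_segment z w \<subseteq> ball z r"
      using w r(1) by (intro closed_segment_subset) auto
    then have seg: "closed_segment z w \<subseteq> {w. slice_lift I w \<in> \<Omega>} \<inter> {w. slice_lift J w \<in> \<Omega>}"
      using r(2) by (rule subset_trans)
    have image: "path_image \<delta> = path_image \<gamma> \<union> closed_segment z w"
      using \<gamma>(3) by (simp add: \<delta>_def path_image_join)
    have \<delta>: "\<delta> \<in> real_start_paths" "pathfinish \<delta> = w"
      using \<gamma> by (auto simp: \<delta>_def real_start_paths_def)
    have I\<delta>: "I \<in> path_units \<Omega> \<delta>" and J\<delta>: "J \<in> path_units \<Omega> \<delta>"
      using \<gamma>(2) J(1) seg by (auto simp: path_units_iff image)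
    obtain a b where ab: "stem_along \<Omega> g \<delta> a b"
      using representation_formula[OF \<Omega> g \<delta>(1)] by blast
    then have "a + I * b = g (slice_lift I w) \<and> a + J * b = g (slice_lift J w)"
      using I\<delta> J\<delta> \<delta>(2) by (simp add: stem_along_def)
    then have "a = G1 w \<and> b = G2 w"
      using stem_pair_eq_iff[OF J(2)[symmetric]] by (simp add: G1_def G2_def)
    then show ?thesis
      using star_prod_eval[OF slice_regular_imp_path_slice[OF \<Omega> g] \<delta>(1) I\<delta> ab refl, of f] \<delta>(2)
      by simp
  qed
  have hol: "left_holomorphic I
      (\<lambda>w. f (slice_lift I w) * G1 w + I * f (slice_lift I w) * G2 w) z"
    unfolding G1_def G2_def
    by (intro left_holomorphic_row_times_stem stem_holomorphic_from_two_units
        slice_regular_left_holomorphic[OF \<Omega>] I J' f g z zJ J(2)[symmetric])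
  show "left_holomorphic I (\<lambda>w. star_prod \<Omega> f g (slice_lift I w)) z"
    by (rule left_holomorphic_transform[OF hol open_ball _ eq]) (use r(1) in simp_all)
qed

lemma slice_regular_const: "restrict (\<lambda>q. c) \<Omega> \<in> slice_regular \<Omega>"
  by (intro restrict_slice_regularI[OF \<Omega>] left_holomorphic_const)

lemma slice_regular_add:
  assumes "f \<in> slice_regular \<Omega>" "g \<in> slice_regular \<Omega>"
  shows "restrict (\<lambda>q. f q + g q) \<Omega> \<in> slice_regular \<Omega>"
  by (intro restrict_slice_regularI[OF \<Omega>] left_holomorphic_add
      slice_regular_left_holomorphic[OF \<Omega>] assms)

lemma slice_regular_scaleR:
  assumes "f \<in> slice_regular \<Omega>"
  shows "restrict (\<lambda>q. a *\<^sub>R f q) \<Omega> \<in> slice_regular \<Omega>"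
  by (intro restrict_slice_regularI[OF \<Omega>] left_holomorphic_scaleR
      slice_regular_left_holomorphic[OF \<Omega>] assms)

section \<open>The algebra laws\<close>

text \<open>By real-path-connectedness, identities between functions on \<open>\<Omega>\<close> can be checked at the ends of
  lifted paths, where the product has its explicit form.\<close>

lemma extensional_eqI_along_paths:
  assumes "F \<in> extensional \<Omega>" "G \<in> extensional \<Omega>"
    and "\<And>\<gamma> I. \<gamma> \<in> real_start_paths \<Longrightarrow> I \<in> path_units \<Omega> \<gamma> \<Longrightarrow>
           F (slice_lift I (pathfinish \<gamma>)) = G (slice_lift I (pathfinish \<gamma>))"
  shows "F = G"
proof (rule extensionalityI[OF assms(1,2)])
  fix q assume "q \<in> \<Omega>"
  then show "F q = G q"
    using exists_path[of q] assms(3) by metis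
qed

lemma star_prod_extensional: "star_prod \<Omega> f g \<in> extensional \<Omega>"
  by (simp add: star_prod_def)

lemma star_prod_at:
  assumes "g \<in> slice_regular \<Omega>" "\<gamma> \<in> real_start_paths" "I \<in> path_units \<Omega> \<gamma>" "stem_along \<Omega> g \<gamma> a b"
  shows "star_prod \<Omega> f g (slice_lift I (pathfinish \<gamma>)) =
    f (slice_lift I (pathfinish \<gamma>)) * a + I * f (slice_lift I (pathfinish \<gamma>)) * b"
  using star_prod_eval[OF slice_regular_imp_path_slice[OF \<Omega> assms(1)] assms(2-4) refl] .

lemma stem_along_add:
  assumes "stem_along \<Omega> f \<gamma> a b" "stem_along \<Omega> g \<gamma> c d"
  shows "stem_along \<Omega> (restrict (\<lambda>q. f q + g q) \<Omega>) \<gamma> (a + c) (b + d)"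
  using assms path_units_finish[of _ \<Omega> \<gamma>] by (simp add: stem_along_def distrib_left)

lemma stem_along_scaleR:
  assumes "stem_along \<Omega> f \<gamma> a b"
  shows "stem_along \<Omega> (restrict (\<lambda>q. r *\<^sub>R f q) \<Omega>) \<gamma> (r *\<^sub>R a) (r *\<^sub>R b)"
  using assms path_units_finish[of _ \<Omega> \<gamma>] by (simp add: stem_along_def scaleR_add_right)

lemma stem_along_const: "stem_along \<Omega> (restrict (\<lambda>q. c) \<Omega>) \<gamma> c 0"
  using path_units_finish[of _ \<Omega> \<gamma>] by (simp add: stem_along_def)

lemma star_prod_assoc:
  assumes g: "g \<in> slice_regular \<Omega>" and h: "h \<in> slice_regular \<Omega>"
  shows "star_prod \<Omega> (star_prod \<Omega> f g) h = star_prod \<Omega> f (star_prod \<Omega> g h)"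
proof (rule extensional_eqI_along_paths[OF star_prod_extensional star_prod_extensional])
  fix \<gamma> I assume \<gamma>: "\<gamma> \<in> real_start_paths" and I: "I \<in> path_units \<Omega> \<gamma>"
  obtain a b c d where ab: "stem_along \<Omega> g \<gamma> a b" and cd: "stem_along \<Omega> h \<gamma> c d"
    using representation_formula[OF \<Omega> _ \<gamma>] g h by meson
  have gh: "stem_along \<Omega> (star_prod \<Omega> g h) \<gamma> (a * c - b * d) (b * c + a * d)"
    by (rule stem_along_star_prod[OF slice_regular_imp_path_slice[OF \<Omega> h] \<gamma> ab cd])
  show "star_prod \<Omega> (star_prod \<Omega> f g) h (slice_lift I (pathfinish \<gamma>)) =
      star_prod \<Omega> f (star_prod \<Omega> g h) (slice_lift I (pathfinish \<gamma>))"
    unfolding star_prod_at[OF h \<gamma> I cd] star_prod_at[OF g \<gamma> I ab]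
      star_prod_at[OF slice_regular_star_prod[OF g h] \<gamma> I gh]
    by (simp add: distrib_left distrib_right left_diff_distrib right_diff_distrib mult.assoc
        imag_units_cancel[OF path_units_imag[OF I]])
qed

lemma star_prod_add_left:
  assumes h: "h \<in> slice_regular \<Omega>"
  shows "star_prod \<Omega> (restrict (\<lambda>q. f q + g q) \<Omega>) h =
    restrict (\<lambda>q. star_prod \<Omega> f h q + star_prod \<Omega> g h q) \<Omega>"
proof (rule extensional_eqI_along_paths[OF star_prod_extensional])
  fix \<gamma> I assume \<gamma>: "\<gamma> \<in> real_start_paths" and I: "I \<in> path_units \<Omega> \<gamma>"
  obtain a b where ab: "stem_along \<Omega> h \<gamma> a b"
    using representation_formula[OF \<Omega> h \<gamma>] by blast
  show "star_prod \<Omega> (restrict (\<lambda>q. f q + g q) \<Omega>) h (slice_lift I (pathfinish \<gamma>)) =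
      restrict (\<lambda>q. star_prod \<Omega> f h q + star_prod \<Omega> g h q) \<Omega> (slice_lift I (pathfinish \<gamma>))"
    by (simp add: star_prod_at[OF h \<gamma> I ab] path_units_finish[OF I] distrib_left distrib_right)
qed simp

lemma star_prod_add_right:
  assumes g: "g \<in> slice_regular \<Omega>" and h: "h \<in> slice_regular \<Omega>"
  shows "star_prod \<Omega> f (restrict (\<lambda>q. g q + h q) \<Omega>) =
    restrict (\<lambda>q. star_prod \<Omega> f g q + star_prod \<Omega> f h q) \<Omega>"
proof (rule extensional_eqI_along_paths[OF star_prod_extensional])
  fix \<gamma> I assume \<gamma>: "\<gamma> \<in> real_start_paths" and I: "I \<in> path_units \<Omega> \<gamma>"
  obtain a b c d where ab: "stem_along \<Omega> g \<gamma> a b" and cd: "stem_along \<Omega> h \<gamma> c d"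
    using representation_formula[OF \<Omega> _ \<gamma>] g h by meson
  show "star_prod \<Omega> f (restrict (\<lambda>q. g q + h q) \<Omega>) (slice_lift I (pathfinish \<gamma>)) =
      restrict (\<lambda>q. star_prod \<Omega> f g q + star_prod \<Omega> f h q) \<Omega> (slice_lift I (pathfinish \<gamma>))"
    by (simp add: star_prod_at[OF g \<gamma> I ab] star_prod_at[OF h \<gamma> I cd] path_units_finish[OF I]
        star_prod_at[OF slice_regular_add[OF g h] \<gamma> I stem_along_add[OF ab cd]] distrib_left)
qed simp

lemma star_prod_scaleR_left:
  assumes g: "g \<in> slice_regular \<Omega>"
  shows "star_prod \<Omega> (restrict (\<lambda>q. r *\<^sub>R f q) \<Omega>) g = restrict (\<lambda>q. r *\<^sub>R star_prod \<Omega> f g q) \<Omega>"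
proof (rule extensional_eqI_along_paths[OF star_prod_extensional])
  fix \<gamma> I assume \<gamma>: "\<gamma> \<in> real_start_paths" and I: "I \<in> path_units \<Omega> \<gamma>"
  obtain a b where ab: "stem_along \<Omega> g \<gamma> a b"
    using representation_formula[OF \<Omega> g \<gamma>] by blast
  show "star_prod \<Omega> (restrict (\<lambda>q. r *\<^sub>R f q) \<Omega>) g (slice_lift I (pathfinish \<gamma>)) =
      restrict (\<lambda>q. r *\<^sub>R star_prod \<Omega> f g q) \<Omega> (slice_lift I (pathfinish \<gamma>))"
    by (simp add: star_prod_at[OF g \<gamma> I ab] path_units_finish[OF I] scaleR_add_right)
qed simp

lemma star_prod_scaleR_right:
  assumes g: "g \<in> slice_regular \<Omega>"
  shows "star_prod \<Omega> f (restrict (\<lambda>q. r *\<^sub>R g q) \<Omega>) = restrict (\<lambda>q. r *\<^sub>R star_prod \<Omega> f g q) \<Omega>"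
proof (rule extensional_eqI_along_paths[OF star_prod_extensional])
  fix \<gamma> I assume \<gamma>: "\<gamma> \<in> real_start_paths" and I: "I \<in> path_units \<Omega> \<gamma>"
  obtain a b where ab: "stem_along \<Omega> g \<gamma> a b"
    using representation_formula[OF \<Omega> g \<gamma>] by blast
  show "star_prod \<Omega> f (restrict (\<lambda>q. r *\<^sub>R g q) \<Omega>) (slice_lift I (pathfinish \<gamma>)) =
      restrict (\<lambda>q. r *\<^sub>R star_prod \<Omega> f g q) \<Omega> (slice_lift I (pathfinish \<gamma>))"
    by (simp add: star_prod_at[OF g \<gamma> I ab] path_units_finish[OF I] scaleR_add_right
        star_prod_at[OF slice_regular_scaleR[OF g] \<gamma> I stem_along_scaleR[OF ab]])
qed simp

lemma star_prod_one_left: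
  assumes f: "f \<in> slice_regular \<Omega>"
  shows "star_prod \<Omega> (restrict (\<lambda>q. 1) \<Omega>) f = f"
proof (rule extensional_eqI_along_paths[OF star_prod_extensional])
  show "f \<in> extensional \<Omega>"
    using f by (simp add: slice_regular_def)
  fix \<gamma> I assume \<gamma>: "\<gamma> \<in> real_start_paths" and I: "I \<in> path_units \<Omega> \<gamma>"
  obtain a b where ab: "stem_along \<Omega> f \<gamma> a b"
    using representation_formula[OF \<Omega> f \<gamma>] by blast
  then have "f (slice_lift I (pathfinish \<gamma>)) = a + I * b"
    using I by (simp add: stem_along_def)
  then show "star_prod \<Omega> (restrict (\<lambda>q. 1) \<Omega>) f (slice_lift I (pathfinish \<gamma>)) =
      f (slice_lift I (pathfinish \<gamma>))"
    by (simp add: star_prod_at[OF f \<gamma> I ab] path_units_finish[OF I])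
qed

lemma star_prod_one_right:
  assumes "f \<in> extensional \<Omega>"
  shows "star_prod \<Omega> f (restrict (\<lambda>q. 1) \<Omega>) = f"
  by (rule extensional_eqI_along_paths[OF star_prod_extensional assms])
    (simp add: star_prod_at[OF slice_regular_const _ _ stem_along_const])

end

theorem theorem4p4:
  fixes \<Omega> :: "(quat ^ 'n :: {finite, linorder}) set"
  assumes "openin slice_topology \<Omega>" and "self_stem_preserving \<Omega>"
  shows "assoc_unital_algebra (ring_of_type_algebra :: real ring) (SR_algebra \<Omega>)"
proof -
  let ?R = "ring_of_type_algebra :: real ring" and ?M = "SR_algebra \<Omega>"
  note \<Omega> = assms
  have R: "mult ?R = (*)" "one ?R = 1" "add ?R = (+)"
    by (simp_all add: ring_of_type_algebra_def)
  have M: "carrier ?M = slice_regular \<Omega>" "mult ?M = star_prod \<Omega>"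
    "one ?M = restrict (\<lambda>q. 1) \<Omega>" "zero ?M = restrict (\<lambda>q. 0) \<Omega>"
    "add ?M = (\<lambda>f g. restrict (\<lambda>q. f q + g q) \<Omega>)"
    "smult ?M = (\<lambda>a f. restrict (\<lambda>q. a *\<^sub>R f q) \<Omega>)"
    by (simp_all add: SR_algebra_def)
  have ext: "f \<in> extensional \<Omega>" if "f \<in> slice_regular \<Omega>" for f
    using that by (simp add: slice_regular_def)
  note extI = extensionalityI[of _ \<Omega>]
  have group: "abelian_group ?M"
  proof (rule abelian_groupI, unfold M)
    fix f assume f: "f \<in> slice_regular \<Omega>"
    show "\<exists>g\<in>slice_regular \<Omega>. restrict (\<lambda>q. g q + f q) \<Omega> = restrict (\<lambda>q. 0) \<Omega>"
      by (rule bexI[OF _ slice_regular_scaleR[OF \<Omega> f, of "-1"]]) (auto simp: restrict_def)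
    show "restrict (\<lambda>q. restrict (\<lambda>q. 0) \<Omega> q + f q) \<Omega> = f"
      by (rule extI) (simp_all add: ext[OF f])
  qed (auto intro!: slice_regular_add[OF \<Omega>] slice_regular_const[OF \<Omega>] extI simp: algebra_simps)
  have ring: "ring ?M"
  proof (rule ringI[OF group])
    show "monoid ?M"
      by (rule monoidI)
        (simp_all add: M slice_regular_star_prod[OF \<Omega>] slice_regular_const[OF \<Omega>]
          star_prod_assoc[OF \<Omega>] star_prod_one_left[OF \<Omega>] star_prod_one_right[OF \<Omega>] ext)
  qed (simp_all add: M star_prod_add_left[OF \<Omega>] star_prod_add_right[OF \<Omega>])
  have module: "module ?R ?M"
  proof (rule moduleI[OF cring_from_type_algebra group], unfold M R)
    show "restrict (\<lambda>q. 1 *\<^sub>R f q) \<Omega> = f" if "f \<in> slice_regular \<Omega>" for f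
      by (rule extI) (simp_all add: ext[OF that])
  qed (auto intro!: slice_regular_scaleR[OF \<Omega>] extI simp: algebra_simps)
  show ?thesis
  proof (rule assoc_unital_algebra.intro[OF module ring], rule assoc_unital_algebra_axioms.intro, unfold M)
  qed (simp_all add: star_prod_scaleR_left[OF \<Omega>] star_prod_scaleR_right[OF \<Omega>])
qed

end
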